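(* Let $\phi$ be a Drinfeld module over $K$ of rank $2$ with $\phi_\theta=\theta+a_1\tau+a_2\tau^2$, $a_1,a_2\in K$, $a_2\neq 0$. If $v(a_1)\geq \frac{v(a_2)-q}{q+1}$, then $K_\infty(\Lambda_\phi)=K_\infty(\phi[\theta])$, and the degree $[K_\infty(\Lambda_\phi):K_\infty]$ divides $(q^2-1)(q^2-q)$.
   Context: Let $\mathbb{F}_q$ be the finite field with $q$ elements, $K=\mathbb{F}_q(\theta)$, $A=\mathbb{F}_q[\theta]$, $K_\infty=\mathbb{F}_q((1/\theta))$, and $\overline{K}_\infty$ an algebraic closure of $K_\infty$. Let $v$ be the valuation on $K_\infty$ with $v(\theta)=-1$, extended to a $\mathbb{Q}$-valued valuation on $\overline{K}_\infty$ (with $v(0)=\infty$). Let $\tau$ be the $q$-power Frobenius and $K\{\tau\}$ the skew polynomial ring with $\tau c=c^q\tau$. A Drinfeld module over $K$ of rank $r$ is an $\mathbb{F}_q$-algebra homomorphism $\phi:A\to K\{\tau\}$ with $\phi_\theta=\theta+a_1\tau+\dots+a_r\tau^r$, $a_r\neq0$. Its exponential $\exp_\phi(x)=\sum_{i\ge0}\alpha_ix^{q^i}$, $\alpha_0=1$, is the unique $\mathbb{F}_q$-linear entire power series with $\exp_\phi(ax)=\phi_a(\exp_\phi(x))$ for $a\in A$; its kernel $\Lambda_\phi\subseteq\overline{K}_\infty$ is the period lattice, a discrete $A$-submodule of rank $r$. For $a\in A$, $\phi[a]=\{x\in\overline{K}_\infty\mid\phi_a(x)=0\}$. $K_\infty(S)$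 denotes the field generated over $K_\infty$ by $S\subseteq\overline{K}_\infty$. *)

theory Defs
  imports "HOL-Algebra.Algebraic_Closure_Type" "HOL-Library.Extended_Real" "HOL-Library.Cardinality"
begin

text \<open>F_q is a finite field type 'a, q = CARD('a). K_infinity = F_q((1/theta)) is the
  Laurent series field 'a fls in the variable X = 1/theta, so theta = fls_X_inv.
  The algebraic closure of K_infinity is the type 'a fls alg_closure, with embedding to_ac.\<close>

abbreviation theta :: "'a::{finite,field} fls" where
  "theta \<equiv> fls_X_inv"

definition inK :: "'a::{finite,field} fls \<Rightarrow> bool" where
  "inK f \<longleftrightarrow> (\<exists>p r :: 'a poly. r \<noteq> 0 \<and>
      f = poly (map_poly fls_const p) theta / poly (map_poly fls_const r) theta)"

definition vK :: "'a::{finite,field} fls \<Rightarrow> ereal" where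
  "vK f = (if f = 0 then PInfty else ereal (of_int (fls_subdegree f)))"

definition min_poly :: "'a::{finite,field} fls alg_closure \<Rightarrow> 'a fls poly" where
  "min_poly x = (THE p. lead_coeff p = 1 \<and> poly (map_poly to_ac p) x = 0 \<and>
      (\<forall>r. r \<noteq> 0 \<and> poly (map_poly to_ac r) x = 0 \<longrightarrow> degree p \<le> degree r))"

text \<open>The (unique) extension of v to the algebraic closure:
  v(x) = v(N(x)) / [K_infinity(x) : K_infinity], N(x) = +-(constant term of min. poly).\<close>
definition vL :: "'a::{finite,field} fls alg_closure \<Rightarrow> ereal" where
  "vL x = (if x = 0 then PInfty else
     ereal (real_of_int (fls_subdegree (coeff (min_poly x) 0)) / real (degree (min_poly x))))"

definition phi_theta :: "'a::{finite,field} fls \<Rightarrow> 'a fls \<Rightarrow> 'a fls alg_closure \<Rightarrow> 'a fls alg_closure" where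
  "phi_theta a1 a2 x = to_ac theta * x + to_ac a1 * x ^ CARD('a) + to_ac a2 * x ^ (CARD('a) ^ 2)"

definition torsion_theta :: "'a::{finite,field} fls \<Rightarrow> 'a fls \<Rightarrow> 'a fls alg_closure set" where
  "torsion_theta a1 a2 = {x. phi_theta a1 a2 x = 0}"

text \<open>Coefficients alpha_i of exp_phi, obtained by comparing coefficients of x^(q^i) in
  exp_phi(theta x) = phi_theta(exp_phi(x)):
  alpha_i (theta^(q^i) - theta) = a1 alpha_(i-1)^q + a2 alpha_(i-2)^(q^2).\<close>
fun exp_coeff :: "'a::{finite,field} fls \<Rightarrow> 'a fls \<Rightarrow> nat \<Rightarrow> 'a fls" where
  "exp_coeff a1 a2 0 = 1"
| "exp_coeff a1 a2 (Suc 0) =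
     (a1 * exp_coeff a1 a2 0 ^ CARD('a)) / (theta ^ CARD('a) - theta)"
| "exp_coeff a1 a2 (Suc (Suc n)) =
     (a1 * exp_coeff a1 a2 (Suc n) ^ CARD('a) + a2 * exp_coeff a1 a2 n ^ (CARD('a) ^ 2))
       / (theta ^ (CARD('a) ^ Suc (Suc n)) - theta)"

text \<open>Period lattice: zeros in the algebraic closure of exp_phi, i.e. points where the
  partial sums of the exponential series converge to 0 for the valuation vL.\<close>
definition period_lattice :: "'a::{finite,field} fls \<Rightarrow> 'a fls \<Rightarrow> 'a fls alg_closure set" where
  "period_lattice a1 a2 = {x. ((\<lambda>n. vL (\<Sum>i\<le>n. to_ac (exp_coeff a1 a2 i) * x ^ (CARD('a) ^ i)))
      \<longlongrightarrow> PInfty) sequentially}"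

definition is_subfield :: "'b::field set \<Rightarrow> bool" where
  "is_subfield F \<longleftrightarrow> 0 \<in> F \<and> 1 \<in> F \<and> (\<forall>x\<in>F. \<forall>y\<in>F. x + y \<in> F \<and> x * y \<in> F) \<and>
     (\<forall>x\<in>F. - x \<in> F \<and> inverse x \<in> F)"

definition Kinf_adjoin :: "'a::{finite,field} fls alg_closure set \<Rightarrow> 'a fls alg_closure set" where
  "Kinf_adjoin S = \<Inter>{F. is_subfield F \<and> range to_ac \<subseteq> F \<and> S \<subseteq> F}"

text \<open>[F : K_infinity], the dimension of F as a K_infinity-vector space
  (0 if infinite-dimensional).\<close>
definition ext_degree :: "'a::{finite,field} fls alg_closure set \<Rightarrow> nat" where
  "ext_degree F = vector_space.dim (\<lambda>c x. to_ac c * x) F"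

end

theory Submission
  imports Defs
begin

text \<open>Let \<open>V = \<phi>[\<theta>]\<close>. The hypothesis on \<open>a1\<close> says that all nonzero points of \<open>V\<close> have the same
  absolute value \<open>R\<close>. On the disc of radius \<open>R\<close> the exponential is an isometry, and since finite
  extensions of \<open>K_\<infinity>\<close> are complete its inverse preserves every finite extension. Hence a torsion
  point \<open>x = exp z\<close> and the period \<open>\<theta>z\<close> generate the same field, and an arbitrary period \<open>\<omega>\<close> is
  \<open>\<theta>(z + \<omega>')\<close> where \<open>z\<close> is the logarithm of the torsion point \<open>exp(\<omega>/\<theta>)\<close> and \<open>\<omega>'\<close> is a smaller period.

  For the degree \<open>n\<close> of \<open>K_\<infinity>(V)\<close>, a suitable \<open>g\<close> in \<open>K_\<infinity>\<close> makes \<open>b1 + g b2\<close> a primitive element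
  for every \<open>F_q\<close>-basis \<open>(b1, b2)\<close> of \<open>V\<close>. These elements are distinct, and they form a union of
  conjugacy classes with \<open>n\<close> elements each, so \<open>n\<close> divides the number
  \<open>(q^2 - 1)(q^2 - q)\<close> of bases.

  The extension of the valuation to the algebraic closure comes from Chevalley's theorem. It agrees
  with \<open>vL\<close> because linear maps on finite-dimensional subspaces are bounded, so that conjugate
  elements have the same absolute value.\<close>

section \<open>Valuation rings\<close>

text \<open>Neither multiplicativity nor the ultrametric inequality can be read off from
  \<open>vL\<close>, which is defined by a constant coefficient and a degree. Hence the detour: a
  valuation ring yields both at once in the form of \<open>nrm\<close>, and only then is
  \<open>nrm\<close> compared with \<open>vL\<close>. The value group of the ring is not given in
  advance; it becomes real because some positive power of every nonzero x is a power of \<theta> up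
  to a unit.

  The algebraic closure is neither complete nor separable over \<open>K_\<infinity>\<close>. Limits
  are therefore taken inside one simple extension \<open>adj y\<close>, and the torsion field is
  brought into this form by an explicit generator. The equation of a torsion point supplies both
  this generator and a polynomial with derivative 1 that vanishes at it, which gives separability.

  The number (q^2 - 1)(q^2 - q) is the order of GL_2(F_q), into which the Galois group embeds by its
  action on the torsion. The count is done without groups: the Galois orbits on the bases, all of
  them free, appear as the conjugacy classes of the primitive elements.\<close>

definition is_subring :: "'b::field set \<Rightarrow> bool" where
  "is_subring R \<longleftrightarrow> 1 \<in> R \<and> (\<forall>x\<in>R. \<forall>y\<in>R. x - y \<in> R \<and> x * y \<in> R)"

lemma is_subringD:
  assumes "is_subring R"
  shows "0 \<in> R" "1 \<in> R" "x \<in> R \<Longrightarrow> - x \<in> R" "x \<in> R \<Longrightarrow> y \<in> R \<Longrightarrow> x - y \<in> R"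
    "x \<in> R \<Longrightarrow> y \<in> R \<Longrightarrow> x + y \<in> R" "x \<in> R \<Longrightarrow> y \<in> R \<Longrightarrow> x * y \<in> R"
    "x \<in> R \<Longrightarrow> x ^ n \<in> R"
proof -
  have d: "\<And>x y. x \<in> R \<Longrightarrow> y \<in> R \<Longrightarrow> x - y \<in> R" and m: "\<And>x y. x \<in> R \<Longrightarrow> y \<in> R \<Longrightarrow> x * y \<in> R"
    and o: "1 \<in> R"
    using assms by (auto simp: is_subring_def)
  have z: "0 \<in> R" using d[OF o o] by simp
  have n: "\<And>x. x \<in> R \<Longrightarrow> - x \<in> R" using d[OF z] by fastforce
  show "0 \<in> R" "1 \<in> R" "x \<in> R \<Longrightarrow> - x \<in> R" "x \<in> R \<Longrightarrow> y \<in> R \<Longrightarrow> x - y \<in> R"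
    "x \<in> R \<Longrightarrow> y \<in> R \<Longrightarrow> x * y \<in> R"
    by (fact z o n d m)+
  show "x \<in> R \<Longrightarrow> y \<in> R \<Longrightarrow> x + y \<in> R" using d[of x "- y"] n[of y] by simp
  show "x \<in> R \<Longrightarrow> x ^ n \<in> R" by (induction n) (auto intro: o m)
qed

lemma is_subring_sum:
  "is_subring R \<Longrightarrow> (\<And>i. i \<in> A \<Longrightarrow> f i \<in> R) \<Longrightarrow> sum f A \<in> R"
  by (induction A rule: infinite_finite_induct) (auto intro: is_subringD)

definition ring_adjoin :: "'b::field set \<Rightarrow> 'b \<Rightarrow> 'b set" where
  "ring_adjoin R x = {poly p x |p. \<forall>i. coeff p i \<in> R}"

lemma is_subring_ring_adjoin:
  assumes R: "is_subring R"
  shows "is_subring (ring_adjoin R x)"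
  unfolding is_subring_def
proof (intro conjI ballI)
  show "1 \<in> ring_adjoin R x"
    unfolding ring_adjoin_def
    by (auto intro!: exI[of _ 1] is_subringD[OF R] simp: coeff_1)
next
  fix u v assume "u \<in> ring_adjoin R x" "v \<in> ring_adjoin R x"
  then obtain p r where pr: "\<And>i. coeff p i \<in> R" "\<And>i. coeff r i \<in> R" "u = poly p x" "v = poly r x"
    by (auto simp: ring_adjoin_def)
  show "u - v \<in> ring_adjoin R x" unfolding ring_adjoin_def
    using pr by (auto intro!: exI[of _ "p - r"] is_subringD[OF R])
  show "u * v \<in> ring_adjoin R x" unfolding ring_adjoin_def
    using pr by (auto intro!: exI[of _ "p * r"] is_subring_sum[OF R] is_subringD[OF R] simp: coeff_mult)
qed

lemma subset_ring_adjoin: "is_subring R \<Longrightarrow> R \<subseteq> ring_adjoin R x"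
proof
  fix c assume "is_subring R" "c \<in> R"
  then show "c \<in> ring_adjoin R x"
    unfolding ring_adjoin_def
    by (auto intro!: exI[of _ "[:c:]"] is_subringD simp: coeff_pCons split: nat.split)
qed

lemma mem_ring_adjoin: "is_subring R \<Longrightarrow> x \<in> ring_adjoin R x"
  unfolding ring_adjoin_def
  by (auto intro!: exI[of _ "[:0, 1:]"] is_subringD simp: coeff_pCons split: nat.split)

text \<open>Subrings that are maximal among those not containing \<open>1/t\<close> are valuation rings.\<close>
locale maximal_avoiding =
  fixes R :: "'b::field set" and t :: 'b
  assumes subring: "is_subring R"
    and t_mem: "t \<in> R" and t_nz: "t \<noteq> 0" and inv_t: "inverse t \<notin> R"
    and maximal: "\<And>R'. is_subring R' \<Longrightarrow> R \<subseteq> R' \<Longrightarrow> inverse t \<notin> R' \<Longrightarrow> R' = R"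
begin

lemmas Rs = is_subringD[OF subring]

definition tR :: "'b set" where "tR = (*) t ` R"

lemma tR_sub: "i \<in> tR \<Longrightarrow> i \<in> R" by (auto simp: tR_def Rs t_mem)
lemma tR_mult: "i \<in> tR \<Longrightarrow> r \<in> R \<Longrightarrow> i * r \<in> tR"
  by (auto simp: tR_def Rs t_mem mult.assoc)
lemma tR_add: "i \<in> tR \<Longrightarrow> j \<in> tR \<Longrightarrow> i + j \<in> tR"
  by (auto simp: tR_def Rs simp flip: distrib_left)
lemma tR_0: "0 \<in> tR" by (auto simp: tR_def Rs intro!: image_eqI[of _ _ 0])
lemma one_notin_tR: "1 \<notin> tR"
proof
  assume "1 \<in> tR"
  then obtain r where "r \<in> R" "1 = t * r" by (auto simp: tR_def)
  then show False using inv_t t_nz inverse_unique[of t r] by simp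
qed

lemma inverse_t_in_adjoin:
  assumes "x \<notin> R" shows "inverse t \<in> ring_adjoin R x"
  using maximal[OF is_subring_ring_adjoin[OF subring] subset_ring_adjoin[OF subring]]
    mem_ring_adjoin[OF subring] assms by metis

lemma power_one_minus_tR: "i \<in> tR \<Longrightarrow> \<exists>j\<in>tR. (1 - i) ^ k = 1 - j"
proof (induction k)
  case 0
  then show ?case using tR_0 by (auto intro: bexI[of _ 0])
next
  case (Suc k)
  then obtain j where j: "j \<in> tR" "(1 - i) ^ k = 1 - j" by auto
  have "(1 - i) ^ Suc k = 1 - (i + j * (1 - i))" by (simp add: j algebra_simps)
  moreover have "i + j * (1 - i) \<in> tR"
    using Suc.prems j by (intro tR_add tR_mult Rs tR_sub) auto
  ultimately show ?case by blast
qed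

text \<open>Otherwise 1/t is a polynomial of some degree d in 1/u, where u = 1 - i. Multiplying by
  u^d, which has the form 1 - t r with r in R, puts 1/t - r into R, against the choice of R.\<close>

lemma one_minus_tR_unit:
  assumes "i \<in> tR" shows "inverse (1 - i) \<in> R"
proof (rule ccontr)
  define u where "u = 1 - i"
  have uR: "u \<in> R" using assms by (auto simp: u_def intro: Rs tR_sub)
  have u0: "u \<noteq> 0" using assms one_notin_tR by (auto simp: u_def)
  assume "inverse (1 - i) \<notin> R"
  then have "inverse t \<in> ring_adjoin R (inverse u)" by (simp add: inverse_t_in_adjoin u_def)
  then obtain p where p: "\<And>i. coeff p i \<in> R" "inverse t = poly p (inverse u)"
    by (auto simp: ring_adjoin_def)
  obtain j where j: "j \<in> tR" "u ^ degree p = 1 - j" using power_one_minus_tR[OF assms] u_def by metis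
  then obtain r where r: "r \<in> R" "j = t * r" by (auto simp: tR_def)
  have "u ^ degree p * inverse t = poly (reflect_poly p) u"
    using u0 by (simp add: poly_reflect_poly_nz p(2))
  also have "\<dots> \<in> R"
    unfolding poly_altdef by (intro is_subring_sum[OF subring] Rs uR) (auto simp: coeff_reflect_poly p Rs)
  finally have "inverse t - r \<in> R" using t_nz by (simp add: j r algebra_simps)
  from Rs(5)[OF this r(1)] show False using inv_t by simp
qed

text \<open>If neither \<open>x\<close> nor \<open>1/x\<close> lies in \<open>R\<close>, both satisfy such a relation; the one of lower degree
  can be used to lower the degree of the other.\<close>
definition rel :: "nat \<Rightarrow> 'b \<Rightarrow> bool" where
  "rel n x \<longleftrightarrow> (\<exists>p. degree p \<le> n \<and> (\<forall>i. coeff p i \<in> tR) \<and> poly p x = 1)"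

lemma rel_exists:
  assumes "x \<notin> R" shows "\<exists>n. rel n x"
proof -
  obtain p where p: "\<And>i. coeff p i \<in> R" "inverse t = poly p x"
    using inverse_t_in_adjoin[OF assms] by (auto simp: ring_adjoin_def)
  have "poly (smult t p) x = 1" using t_nz by (simp flip: p(2))
  moreover have "\<forall>i. coeff (smult t p) i \<in> tR" using p by (auto simp: tR_def)
  ultimately show ?thesis unfolding rel_def by blast
qed

lemma rel_descend:
  assumes x0: "x \<noteq> 0" and n: "rel n x" "\<And>k. k < n \<Longrightarrow> \<not> rel k x" and m: "rel m (inverse x)" "m \<le> n"
  shows False
proof -
  obtain p where p: "degree p \<le> n" "\<And>i. coeff p i \<in> tR" "poly p x = 1" using n(1) by (auto simp: rel_def)
  obtain r where r: "degree r \<le> m" "\<And>i. coeff r i \<in> tR" "poly r (inverse x) = 1" using m(1) by (auto simp: rel_def)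
  define k where "k = degree r"
  have k0: "k > 0"
  proof (rule ccontr)
    assume "\<not> k > 0"
    then obtain c where "r = [:c:]" by (metis degree_0_id k_def gr0I)
    then show False using r(2)[of 0] r(3) one_notin_tR by simp
  qed
  define u where "u = inverse (1 - coeff r 0)"
  have uR: "u \<in> R" using one_minus_tR_unit r(2) by (simp add: u_def)
  have u1: "u * (1 - coeff r 0) = 1" unfolding u_def using r(2)[of 0] one_notin_tR by (intro left_inverse) auto
  \<comment> \<open>Multiplying r(1/x) = 1 by x^k and moving the top term over gives s(x) = x^k (1 -
    r_0), with s of degree below k.\<close>
  define s where "s = reflect_poly r - monom (coeff r 0) k"
  have cs: "coeff s i \<in> tR" for i
    using r(2) tR_0 unfolding s_def k_def by (auto simp: coeff_reflect_poly)
  have "degree s \<le> k"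
    unfolding s_def by (intro degree_diff_le) (auto simp: k_def degree_reflect_poly_le degree_monom_le)
  moreover have "coeff s k = 0" by (simp add: s_def k_def coeff_reflect_poly)
  ultimately have ds: "degree s \<le> k - 1"
    by (metis Suc_pred' coeff_eq_0 degree_le k0 le_neq_implies_less le_antisym less_Suc_eq_le not_le)
  have "poly s x = x ^ k * (1 - coeff r 0)"
    using x0 r(3) by (simp add: s_def poly_reflect_poly_nz poly_monom k_def algebra_simps)
  then have sx: "u * poly s x = x ^ k" using u1 by (metis mult.left_commute mult.right_neutral)
  have kn: "k \<le> n" using r(1) m(2) k_def by simp
  \<comment> \<open>The top term of p is rewritten through x^k = u s(x). The coefficients stay in
    \<open>tR\<close> because it is an ideal.\<close>
  define w where "w = (p - monom (coeff p n) n) + smult (coeff p n * u) (monom 1 (n - k) * s)"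
  have "poly w x = poly p x - coeff p n * x ^ n + coeff p n * x ^ (n - k) * (u * poly s x)"
    by (simp add: w_def poly_monom)
  also have "\<dots> = 1" unfolding sx using kn p(3) by (simp add: mult.assoc flip: power_add)
  finally have w1: "poly w x = 1" .
  have cw: "coeff w i \<in> tR" for i
    unfolding w_def using p(2)[of i] p(2)[of n] cs uR tR_0
    by (auto simp: coeff_monom_mult intro!: tR_add tR_mult Rs tR_sub)
  have "degree (p - monom (coeff p n) n) \<le> n - 1"
  proof (rule degree_le, intro allI impI)
    fix i assume "n - 1 < i"
    then show "coeff (p - monom (coeff p n) n) i = 0"
      using p(1) by (cases "i = n") (auto intro: coeff_eq_0)
  qed
  moreover have "degree (monom 1 (n - k) * s) \<le> n - 1"
    using degree_mult_le[of "monom 1 (n-k)" s] ds k0 kn degree_monom_le[of "1::'b" "n-k"] by linarith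
  ultimately have "degree w \<le> n - 1" unfolding w_def
    by (intro degree_add_le) (auto intro: order_trans[OF degree_smult_le])
  then have "rel (n - 1) x" unfolding rel_def using w1 cw by blast
  with n(2) k0 kn show False by simp
qed

lemma valuation: "x \<in> R \<or> inverse x \<in> R"
proof (rule ccontr)
  assume "\<not> ?thesis"
  then have x: "x \<notin> R" "inverse x \<notin> R" and x0: "x \<noteq> 0" "inverse x \<noteq> 0" using Rs(1) by auto
  define n where "n = (\<lambda>x. LEAST n. rel n x)"
  have n: "rel (n y) y" "\<And>k. k < n y \<Longrightarrow> \<not> rel k y" if "y \<notin> R" for y
    unfolding n_def using rel_exists[OF that] by (auto intro: LeastI_ex dest: not_less_Least)
  show False
    using rel_descend[OF x0(1) n[OF x(1)] n(1)[OF x(2)]]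
      rel_descend[OF x0(2) n[OF x(2)], of "n x"] n(1)[OF x(1)] by (cases "n (inverse x) \<le> n x") auto
qed

end

theorem valuation_ring_exists:
  fixes R0 :: "'b::field set"
  assumes "is_subring R0" "t \<in> R0" "t \<noteq> 0" "inverse t \<notin> R0"
  obtains R where "is_subring R" "R0 \<subseteq> R" "inverse t \<notin> R" "\<And>x. x \<in> R \<or> inverse x \<in> R"
proof -
  define A where "A = {R. is_subring R \<and> R0 \<subseteq> R \<and> inverse t \<notin> R}"
  have "\<exists>M\<in>A. \<forall>N\<in>A. M \<subseteq> N \<longrightarrow> N = M"
  proof (rule subset_Zorn_nonempty)
    fix C assume C: "C \<noteq> {}" "subset.chain A C"
    then have ch: "\<And>Y. Y \<in> C \<Longrightarrow> Y \<in> A" "\<And>Y Z. Y \<in> C \<Longrightarrow> Z \<in> C \<Longrightarrow> Y \<subseteq> Z \<or> Z \<subseteq> Y"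
      by (auto simp: subset_chain_def)
    have "is_subring (\<Union>C)"
      unfolding is_subring_def
    proof (intro conjI ballI)
      show "1 \<in> \<Union>C" using C(1) ch(1) by (auto simp: A_def dest: is_subringD(2))
    next
      fix x y assume "x \<in> \<Union>C" "y \<in> \<Union>C"
      then obtain U V where UV: "U \<in> C" "V \<in> C" "x \<in> U" "y \<in> V" by auto
      then obtain Z where Z: "Z \<in> C" "x \<in> Z" "y \<in> Z" using ch(2) by blast
      then have "is_subring Z" using ch(1) by (auto simp: A_def)
      then show "x - y \<in> \<Union>C" "x * y \<in> \<Union>C" using Z is_subringD(4,6) by blast+
    qed
    then show "\<Union>C \<in> A" using C(1) ch(1) unfolding A_def by auto
  qed (use assms in \<open>auto simp: A_def\<close>)
  then obtain M where M: "M \<in> A" "\<And>N. N \<in> A \<Longrightarrow> M \<subseteq> N \<Longrightarrow> N = M" by blast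
  interpret maximal_avoiding M t
    using M assms by unfold_locales (auto simp: A_def)
  show thesis using that[of M] M valuation by (auto simp: A_def)
qed

section \<open>The absolute value on the algebraic closure\<close>

abbreviation ev :: "'a::field poly \<Rightarrow> 'a alg_closure \<Rightarrow> 'a alg_closure" where
  "ev p x \<equiv> poly (map_poly to_ac p) x"

lemma ev_pCons [simp]: "ev (pCons a p) x = to_ac a + x * ev p x"
  by (cases "a = 0 \<and> p = 0") (auto simp: map_poly_pCons)

lemma ev_add [simp]: "ev (p + r) x = ev p x + ev r x"
  by (induction p r rule: poly_induct2) (auto simp: algebra_simps)

lemma ev_smult [simp]: "ev (smult c p) x = to_ac c * ev p x"
  by (induction p) (auto simp: algebra_simps)

lemma ev_minus [simp]: "ev (- p) x = - ev p x"
  by (induction p) (auto simp: algebra_simps)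

lemma ev_diff [simp]: "ev (p - r) x = ev p x - ev r x"
  using ev_add[of p "- r" x] by (simp del: ev_add)

lemma ev_mult [simp]: "ev (p * r) x = ev p x * ev r x"
  by (induction p) (auto simp: algebra_simps)

lemma ev_1 [simp]: "ev 1 x = 1"
  by (simp add: one_pCons)

lemma ev_power [simp]: "ev (p ^ n) x = ev p x ^ n"
  by (induction n) auto

lemma ev_pcompose [simp]: "ev (pcompose p r) x = ev p (ev r x)"
  by (induction p) (auto simp: pcompose_pCons)

lemma ev_monom [simp]: "ev (monom c n) x = to_ac c * x ^ n"
  by (simp add: map_poly_monom poly_monom)

lemma to_ac_power_int: "to_ac (x powi n) = to_ac x powi n"
  by (auto simp: power_int_def)

lemma powi_power: "(x powi a) ^ n = x powi (a * int n)" for x :: "'a::field"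
  by (simp add: power_int_mult)

lemma power_Suc_inverse_power: "x ^ Suc n * inverse x ^ n = x" for x :: "'a::field"
  by (cases "x = 0") (simp_all add: field_simps)

text \<open>A valuation ring of the algebraic closure that contains the power series in 1/\<theta>
  and in which 1/\<theta> is not a unit. Over a finite field the resulting absolute value does not
  depend on the choice, by \<open>vL_eq_nrm\<close>.\<close>

definition vring :: "'a::field fls alg_closure set" where
  "vring = (SOME R. is_subring R \<and> to_ac ` {f. fls_subdegree f \<ge> 0} \<subseteq> R \<and>
     to_ac fls_X_inv \<notin> R \<and> (\<forall>x. x \<in> R \<or> inverse x \<in> R))"

lemma fls_subdegree_diff_ge0:
  fixes f g :: "'a::field fls"
  assumes "fls_subdegree f \<ge> n" "fls_subdegree g \<ge> n" "n \<le> 0"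
  shows "fls_subdegree (f - g) \<ge> n"
proof (cases "f - g = 0")
  case False
  then show ?thesis using assms by (intro fls_subdegree_geI) auto
qed (use assms in auto)

lemma vring:
  shows vring_subring: "is_subring (vring :: 'a::field fls alg_closure set)"
    and to_ac_in_vring: "fls_subdegree f \<ge> 0 \<Longrightarrow> to_ac f \<in> (vring :: 'a fls alg_closure set)"
    and theta_notin_vring: "to_ac fls_X_inv \<notin> (vring :: 'a fls alg_closure set)"
    and vring_total: "x \<in> (vring :: 'a fls alg_closure set) \<or> inverse x \<in> vring"
proof -
  define R0 :: "'a fls alg_closure set" where "R0 = to_ac ` {f. fls_subdegree f \<ge> 0}"
  have "is_subring R0"
    unfolding is_subring_def
  proof (intro conjI ballI)
    show "1 \<in> R0" unfolding R0_def by (rule image_eqI[of _ _ 1]) auto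
  next
    fix x y assume "x \<in> R0" "y \<in> R0"
    then obtain f g :: "'a fls" where fg: "x = to_ac f" "y = to_ac g" "fls_subdegree f \<ge> 0" "fls_subdegree g \<ge> 0"
      by (auto simp: R0_def)
    have "fls_subdegree (f * g) \<ge> 0" using fg(3,4) by (cases "f = 0 \<or> g = 0") auto
    then show "x - y \<in> R0" "x * y \<in> R0"
      unfolding R0_def fg(1,2) using fg(3,4) fls_subdegree_diff_ge0[of 0 f g]
      by (auto intro: image_eqI[of _ _ "f - g"] image_eqI[of _ _ "f * g"] simp flip: to_ac_diff to_ac_mult)
  qed
  moreover have "to_ac fls_X \<in> R0" by (auto simp: R0_def)
  moreover have "inverse (to_ac fls_X) \<notin> R0"
    by (auto simp: R0_def fls_inverse_X simp flip: to_ac_inverse)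
  moreover have "inverse (to_ac fls_X) = to_ac (fls_X_inv :: 'a fls)" "to_ac (fls_X :: 'a fls) \<noteq> 0"
    by (auto simp: fls_inverse_X simp flip: to_ac_inverse)
  ultimately obtain R where "is_subring R" "R0 \<subseteq> R" "to_ac fls_X_inv \<notin> R" "\<And>x. x \<in> R \<or> inverse x \<in> R"
    using valuation_ring_exists[of R0 "to_ac fls_X"] by metis
  then have "\<exists>R :: 'a fls alg_closure set. is_subring R \<and> to_ac ` {f. fls_subdegree f \<ge> 0} \<subseteq> R \<and>
     to_ac fls_X_inv \<notin> R \<and> (\<forall>x. x \<in> R \<or> inverse x \<in> R)"
    unfolding R0_def by blast
  from someI_ex[OF this]
  show "is_subring (vring :: 'a fls alg_closure set)"
    "fls_subdegree f \<ge> 0 \<Longrightarrow> to_ac f \<in> (vring :: 'a fls alg_closure set)"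
    "to_ac fls_X_inv \<notin> (vring :: 'a fls alg_closure set)"
    "x \<in> (vring :: 'a fls alg_closure set) \<or> inverse x \<in> vring"
    unfolding vring_def[symmetric] by auto
qed

lemmas vringD = is_subringD[OF vring_subring]

definition vunit :: "'a::field fls alg_closure \<Rightarrow> bool" where
  "vunit z \<longleftrightarrow> z \<noteq> 0 \<and> z \<in> vring \<and> inverse z \<in> vring"

lemma vunit_1: "vunit 1" by (simp add: vunit_def vringD)
lemma vunit_mult: "vunit x \<Longrightarrow> vunit y \<Longrightarrow> vunit (x * y)"
  by (auto simp: vunit_def vringD)
lemma vunit_inverse: "vunit x \<Longrightarrow> vunit (inverse x)"
  by (auto simp: vunit_def)
lemma vunit_power: "vunit x \<Longrightarrow> vunit (x ^ n)"
  by (induction n) (auto simp: vunit_1 vunit_mult)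

abbreviation \<Theta> :: "'a::field fls alg_closure" where "\<Theta> \<equiv> to_ac fls_X_inv"

lemma inverse_theta_in_vring: "inverse \<Theta> \<in> vring"
  by (auto simp: fls_inverse_X_inv to_ac_in_vring simp flip: to_ac_inverse)

lemma vunit_theta_powi:
  assumes "vunit ((\<Theta> :: 'a::field fls alg_closure) powi k)" shows "k = 0"
proof -
  have *: "(\<Theta> :: 'a fls alg_closure) ^ Suc n \<notin> vring" for n
  proof
    assume "(\<Theta> :: 'a fls alg_closure) ^ Suc n \<in> vring"
    then have "\<Theta> ^ Suc n * inverse \<Theta> ^ n \<in> (vring :: 'a fls alg_closure set)"
      by (rule vringD(6)[OF _ vringD(7)[OF inverse_theta_in_vring]])
    also have "\<Theta> ^ Suc n * inverse \<Theta> ^ n = (\<Theta> :: 'a fls alg_closure)"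
      by (rule power_Suc_inverse_power)
    finally show False by (rule notE[OF theta_notin_vring])
  qed
  show ?thesis
  proof (rule ccontr)
    assume "k \<noteq> 0"
    then obtain n where "k = int (Suc n) \<or> k = - int (Suc n)"
      by (metis not0_implies_Suc int_cases2 of_nat_0 minus_zero)
    then show False using assms *[of n] unfolding vunit_def
      by (auto simp: power_int_minus power_int_of_nat simp del: power_Suc of_nat_Suc)
  qed
qed

lemma vunit_to_ac:
  assumes "f \<noteq> 0"
  shows "vunit (to_ac f * \<Theta> powi (fls_subdegree f))"
proof -
  define g where "g = f * fls_X_inv powi (fls_subdegree f)"
  have "fls_subdegree g = 0" "g \<noteq> 0" using assms by (simp_all add: g_def)
  moreover have "fls_subdegree (inverse g) = 0" using calculation by (simp add: fls_inverse_subdegree)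
  ultimately have "vunit (to_ac g)" by (simp add: vunit_def to_ac_in_vring flip: to_ac_inverse)
  then show ?thesis by (simp add: g_def to_ac_power_int)
qed

lemma vring_max:
  assumes "finite I" "I \<noteq> {}" "\<And>i. i \<in> I \<Longrightarrow> f i \<noteq> 0"
  shows "\<exists>m\<in>I. \<forall>i\<in>I. f i / f m \<in> vring"
  using assms
proof (induction rule: finite_ne_induct)
  case (singleton x)
  then show ?case by (auto simp: vringD)
next
  case (insert x I)
  then obtain m where m: "m \<in> I" "\<And>i. i \<in> I \<Longrightarrow> f i / f m \<in> vring" by auto
  have nz: "f x \<noteq> 0" "f m \<noteq> 0" using insert m by auto
  show ?case
  proof (cases "f x / f m \<in> vring")
    case True
    then show ?thesis using m by auto
  next
    case False
    then have *: "f m / f x \<in> vring" using vring_total[of "f x / f m"] by (simp add: inverse_eq_divide)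
    have "f i / f x \<in> vring" if "i \<in> I" for i
      using vringD(6)[OF m(2)[OF that] *] nz by simp
    then show ?thesis using nz by (auto simp: vringD)
  qed
qed

text \<open>Two terms of maximal value in an algebraic equation for \<open>x\<close> must have the same value.\<close>
lemma nrm_ex:
  assumes x: "x \<noteq> (0 :: 'a::field fls alg_closure)"
  shows "\<exists>(b::nat) a. b > 0 \<and> vunit (x ^ b * \<Theta> powi (- a))"
proof -
  obtain p :: "'a fls poly" where p: "p \<noteq> 0" "ev p x = 0" by (rule alg_closure_algebraic)
  define I where "I = {i. coeff p i \<noteq> 0}"
  define f where "f = (\<lambda>i. to_ac (coeff p i) * x ^ i)"
  have fin: "finite I" unfolding I_def
    by (rule finite_subset[of _ "{..degree p}"]) (auto simp: le_degree)
  have nz: "f i \<noteq> 0" if "i \<in> I" for i using that x by (auto simp: f_def I_def)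
  have "I \<noteq> {}" using p(1) by (auto simp: I_def poly_eq_iff)
  then obtain m where m: "m \<in> I" "\<And>i. i \<in> I \<Longrightarrow> f i / f m \<in> vring"
    using vring_max[OF fin, of f] nz by blast
  have "(\<Sum>i\<in>I. f i) = (\<Sum>i\<le>degree p. f i)"
    by (rule sum.mono_neutral_left) (auto simp: I_def f_def le_degree)
  also have "\<dots> = 0" using p(2) by (simp add: poly_altdef f_def coeff_map_poly degree_map_poly)
  finally have s0: "f m + (\<Sum>i\<in>I-{m}. f i) = 0" using sum.remove[OF fin m(1)] by metis
  have "I - {m} \<noteq> {}" using s0 nz[OF m(1)] by (metis add.right_neutral sum.empty)
  \<comment> \<open>k is dominant among the remaining terms. Since \<open>f m\<close> is minus their
    sum, \<open>f m / f k\<close> lies in the ring too, so the two terms have equal value.\<close>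
  then obtain k where k: "k \<in> I - {m}" "\<And>i. i \<in> I - {m} \<Longrightarrow> f i / f k \<in> vring"
    using vring_max[of "I - {m}" f] nz fin by blast
  have "f m = - (\<Sum>i\<in>I-{m}. f i)" using s0 by (simp add: eq_neg_iff_add_eq_0)
  then have "f m / f k = - (\<Sum>i\<in>I-{m}. f i / f k)" by (simp add: sum_divide_distrib)
  also have "\<dots> \<in> vring" by (intro vringD is_subring_sum[OF vring_subring] k(2))
  finally have "vunit (f k / f m)"
    unfolding vunit_def using m k nz by (auto simp: inverse_eq_divide)
  moreover have c0: "coeff p k \<noteq> 0" "coeff p m \<noteq> 0" using k m by (auto simp: I_def)
  define c where "c = coeff p k / coeff p m"
  have "f k / f m = to_ac c * x powi (int k - int m)"
    using x by (simp add: f_def c_def power_int_diff)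
  ultimately have u: "vunit (to_ac c * x powi (int k - int m))" by simp
  have "c \<noteq> 0" using c0 by (simp add: c_def)
  from vunit_mult[OF u vunit_inverse[OF vunit_to_ac[OF this]]]
  have u2: "vunit (x powi (int k - int m) * \<Theta> powi (- fls_subdegree c))"
    using \<open>c \<noteq> 0\<close> by (simp add: power_int_minus field_simps)
  show ?thesis
  proof (cases "k > m")
    case True
    then obtain n where n: "n > 0" "int k - int m = int n"
      by (metis of_nat_diff less_imp_le zero_less_diff)
    have "vunit (x ^ n * \<Theta> powi (- fls_subdegree c))"
      using u2 unfolding n(2) by (simp only: power_int_of_nat)
    with n(1) show ?thesis by blast
  next
    case False
    with k(1) have "k < m" by auto
    then obtain n where n: "n > 0" "int k - int m = - int n"
      by (metis of_nat_diff less_imp_le zero_less_diff minus_diff_eq)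
    have "vunit (inverse (x powi (- int n) * \<Theta> powi (- fls_subdegree c)))"
      using vunit_inverse[OF u2] unfolding n(2) .
    then have "vunit (x ^ n * \<Theta> powi (- (- fls_subdegree c)))"
      by (simp only: power_int_minus power_int_of_nat inverse_mult_distrib inverse_inverse_eq)
    with n(1) show ?thesis by blast
  qed
qed

text \<open>Normalized by \<open>|\<theta>| = 2\<close>: \<open>x^b\<close> equals \<open>\<theta>^a\<close> up to a unit of the valuation ring.\<close>
definition nrm :: "'a::field fls alg_closure \<Rightarrow> real" where
  "nrm x = (if x = 0 then 0 else
     2 powr (SOME r. \<exists>b a. b > 0 \<and> r = of_int a / real b \<and> vunit (x ^ b * \<Theta> powi (- a))))"

text \<open>The exponent is independent of the pair (b, a): raising two such relations to powers
  with a common exponent of x and dividing leaves a unit power of \<theta>, which must be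
  trivial.\<close>

lemma nrm_eqI:
  assumes "x \<noteq> 0" "b > 0" "vunit (x ^ b * \<Theta> powi (- a))"
  shows "nrm x = 2 powr (of_int a / real b)"
proof -
  let ?P = "\<lambda>r. \<exists>b a. b > 0 \<and> r = of_int a / real b \<and> vunit (x ^ b * \<Theta> powi (- a))"
  have "(SOME r. ?P r) = of_int a / real b"
  proof (rule some_equality)
    show "?P (of_int a / real b)" using assms by blast
  next
    fix r assume "?P r"
    then obtain b' a' where ba': "b' > 0" "r = of_int a' / real b'" "vunit (x ^ b' * \<Theta> powi (- a'))" by blast
    have "vunit ((x ^ b' * \<Theta> powi (- a')) ^ b * inverse ((x ^ b * \<Theta> powi (- a)) ^ b'))"
      by (intro vunit_mult vunit_inverse vunit_power ba' assms)
    also have "(x ^ b' * \<Theta> powi (- a')) ^ b * inverse ((x ^ b * \<Theta> powi (- a)) ^ b')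
        = \<Theta> powi (- a' * int b - (- a * int b'))"
      using assms(1)
      by (simp add: power_mult_distrib power_int_diff powi_power power_int_minus field_simps flip: power_mult)
    finally have "- a' * int b - (- a * int b') = 0" by (rule vunit_theta_powi)
    then have "a' * int b = a * int b'" by simp
    then have "of_int a' * real b = of_int a * real b'" by (metis of_int_mult of_int_of_nat_eq)
    then show "r = of_int a / real b" using ba'(1,2) assms(2) by (simp add: frac_eq_eq)
  qed
  then show ?thesis using assms(1) by (simp add: nrm_def)
qed

lemma nrm_cases:
  assumes "x \<noteq> 0"
  obtains b a where "(b::nat) > 0" "vunit (x ^ b * \<Theta> powi (- a))" "nrm x = 2 powr (of_int a / real b)"
  using nrm_ex[OF assms] nrm_eqI[OF assms] by blast

lemma nrm_0 [simp]: "nrm 0 = 0" by (simp add: nrm_def)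
lemma nrm_ge0 [simp]: "nrm x \<ge> 0" by (simp add: nrm_def)
lemma nrm_eq_0 [simp]: "nrm x = 0 \<longleftrightarrow> x = 0" by (simp add: nrm_def)
lemma nrm_pos [simp]: "nrm x > 0 \<longleftrightarrow> x \<noteq> 0" by (simp add: nrm_def)

lemma nrm_mult [simp]: "nrm (x * y) = nrm x * nrm y"
proof (cases "x = 0 \<or> y = 0")
  case False
  then obtain b a b' a' where xy: "(b::nat) > 0" "vunit (x ^ b * \<Theta> powi (- a))" "nrm x = 2 powr (of_int a / real b)"
    "(b'::nat) > 0" "vunit (y ^ b' * \<Theta> powi (- a'))" "nrm y = 2 powr (of_int a' / real b')"
    by (metis nrm_cases)
  have "vunit ((x ^ b * \<Theta> powi (- a)) ^ b' * (y ^ b' * \<Theta> powi (- a')) ^ b)"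
    by (intro vunit_mult vunit_power xy)
  also have "(x ^ b * \<Theta> powi (- a)) ^ b' * (y ^ b' * \<Theta> powi (- a')) ^ b
     = (x * y) ^ (b * b') * \<Theta> powi (- (a * int b' + a' * int b))"
  proof -
    have e: "- (a * int b' + a' * int b) = - a * int b' + - a' * int b" by simp
    have m: "x ^ (b * b') = (x ^ b) ^ b'" "y ^ (b * b') = (y ^ b') ^ b"
      by (rule power_mult) (metis power_mult mult.commute)
    show ?thesis unfolding e
      by (subst power_int_add) (simp_all only: power_mult_distrib powi_power m mult.assoc mult.left_commute not_False_eq_True to_ac_eq_0_iff fls_X_inv_nonzero simp_thms)
  qed
  finally have u: "vunit ((x * y) ^ (b * b') * \<Theta> powi (- (a * int b' + a' * int b)))" .
  have "x * y \<noteq> 0" "b * b' > 0" using False xy(1,4) by simp_all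
  then have "nrm (x * y) = 2 powr (of_int (a * int b' + a' * int b) / real (b * b'))"
    using u by (rule nrm_eqI)
  also have "of_int (a * int b' + a' * int b) / real (b * b') = of_int a / real b + of_int a' / real b'"
    using xy(1,4) by (simp add: add_frac_eq)
  finally show ?thesis by (simp add: xy(3,6) powr_add)
qed auto

lemma nrm_1 [simp]: "nrm 1 = 1"
  using nrm_eqI[of 1 1 0] vunit_1 by simp

lemma nrm_power [simp]: "nrm (x ^ n) = nrm x ^ n"
  by (induction n) auto

lemma nrm_inverse [simp]: "nrm (inverse x) = inverse (nrm x)"
proof (cases "x = 0")
  case False
  then have "nrm x * nrm (inverse x) = 1" by (simp flip: nrm_mult)
  then show ?thesis by (simp add: inverse_unique)
qed auto

lemma nrm_divide [simp]: "nrm (x / y) = nrm x / nrm y"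
  by (simp add: divide_inverse)

lemma nrm_le_1_if_vring:
  assumes "x \<in> vring" shows "nrm x \<le> 1"
proof (cases "x = 0")
  case False
  then obtain b a where ba: "(b::nat) > 0" "vunit (x ^ b * \<Theta> powi (- a))" "nrm x = 2 powr (of_int a / real b)"
    by (rule nrm_cases)
  have "\<not> a > 0"
  proof
    assume "a > 0"
    then obtain n where n: "a = int (Suc n)" by (metis pos_int_cases not0_implies_Suc less_numeral_extra(3))
    define y where "y = x ^ b * \<Theta> powi (- a)"
    have "inverse y * x ^ b * (inverse \<Theta>) ^ n \<in> vring"
      using ba(2) assms unfolding y_def[symmetric] vunit_def
      by (intro vringD inverse_theta_in_vring) auto
    also have "inverse y * x ^ b * (inverse \<Theta>) ^ n = \<Theta>"
    proof -
      have "inverse y = inverse (x ^ b) * \<Theta> ^ Suc n"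
        unfolding y_def n by (simp add: power_int_minus power_int_of_nat del: of_nat_Suc power_Suc)
      then have "inverse y * x ^ b * inverse \<Theta> ^ n = (inverse (x ^ b) * x ^ b) * (\<Theta> ^ Suc n * inverse \<Theta> ^ n)"
        by (simp only: ac_simps)
      then show ?thesis using False by (simp only: power_Suc_inverse_power) simp
    qed
    finally show False by (rule notE[OF theta_notin_vring])
  qed
  then have "of_int a / real b \<le> 0" using ba(1) by (simp add: divide_le_0_iff)
  then have "2 powr (of_int a / real b) \<le> 2 powr (0::real)" by (rule powr_mono) simp
  then show ?thesis using ba(3) by simp
qed auto

text \<open>For value exactly 1 this is integral closedness of a valuation ring: x^b lies in the
  ring, and if x did not, then x = x^b (1/x)^(b-1) would still be a product of ring
  elements.\<close>

lemma vring_if_nrm_le_1: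
  assumes "nrm x \<le> 1" shows "x \<in> vring"
proof (rule ccontr)
  assume n: "x \<notin> vring"
  then have iv: "inverse x \<in> vring" and x0: "x \<noteq> 0" using vring_total vringD(1) by blast+
  have "nrm (inverse x) \<le> 1" using iv by (rule nrm_le_1_if_vring)
  then have "nrm x = 1" using assms x0 by (simp add: field_simps)
  obtain b a where ba: "(b::nat) > 0" "vunit (x ^ b * \<Theta> powi (- a))" "nrm x = 2 powr (of_int a / real b)"
    using x0 by (rule nrm_cases)
  have "a = 0" using ba \<open>nrm x = 1\<close> by (simp add: powr_eq_one_iff)
  then have "x ^ b \<in> vring" using ba by (simp add: vunit_def)
  then have "x ^ b * inverse x ^ (b - 1) \<in> vring" by (rule vringD(6)[OF _ vringD(7)[OF iv]])
  also have "x ^ b * inverse x ^ (b - 1) = x"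
    using ba(1) power_Suc_inverse_power[of x "b - 1"] by (simp del: power_Suc)
  finally show False using n by simp
qed

lemma nrm_minus [simp]: "nrm (- x) = nrm x"
proof -
  have "nrm (- 1 :: 'a fls alg_closure) ^ 2 = 1" by (simp flip: nrm_power)
  then have "nrm (- 1 :: 'a fls alg_closure) = 1" 
    using nrm_ge0[of "- 1 :: 'a fls alg_closure"] unfolding power2_eq_1_iff by linarith
  then show ?thesis using nrm_mult[of "-1" x] by simp
qed

lemma nrm_diff_commute: "nrm (x - y) = nrm (y - x)"
  using nrm_minus[of "x - y"] by simp

lemma nrm_add: "nrm (x + y) \<le> max (nrm x) (nrm y)"
proof -
  have *: "nrm (x + y) \<le> nrm y" if "nrm x \<le> nrm y" for x y :: "'a fls alg_closure"
  proof (cases "y = 0")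
    case False
    then have "x / y \<in> vring" using that by (intro vring_if_nrm_le_1) (simp add: divide_le_eq)
    then have "nrm (1 + x / y) \<le> 1" by (intro nrm_le_1_if_vring vringD)
    then have "nrm (y * (1 + x / y)) \<le> nrm y" using mult_left_mono[of _ 1 "nrm y"] by simp
    then show ?thesis using False by (simp add: field_simps)
  qed (use that in auto)
  show ?thesis using *[of x y] *[of y x] by (cases "nrm x \<le> nrm y") (auto simp: add.commute max_def)
qed

lemma nrm_add_le: "nrm x \<le> r \<Longrightarrow> nrm y \<le> r \<Longrightarrow> nrm (x + y) \<le> r"
  using nrm_add[of x y] by simp

lemma nrm_diff_le: "nrm x \<le> r \<Longrightarrow> nrm y \<le> r \<Longrightarrow> nrm (x - y) \<le> r"
  using nrm_add_le[of x r "- y"] by simp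

lemma nrm_sum_le: "(\<And>i. i \<in> A \<Longrightarrow> nrm (f i) \<le> r) \<Longrightarrow> r \<ge> 0 \<Longrightarrow> nrm (sum f A) \<le> r"
  by (induction A rule: infinite_finite_induct) (auto intro: nrm_add_le)

lemma nrm_to_ac:
  assumes "f \<noteq> 0" shows "nrm (to_ac f) = 2 powr (- of_int (fls_subdegree f))"
  using nrm_eqI[of "to_ac f" 1 "- fls_subdegree f"] vunit_to_ac[OF assms] assms by simp

lemma nrm_theta [simp]: "nrm \<Theta> = 2"
  by (simp add: nrm_to_ac)

section \<open>Completeness of finite extensions\<close>

abbreviation conv :: "(nat \<Rightarrow> 'a::field fls alg_closure) \<Rightarrow> 'a fls alg_closure \<Rightarrow> bool" where
  "conv s l \<equiv> (\<lambda>n. nrm (s n - l)) \<longlonglongrightarrow> 0"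

text \<open>For an ultrametric absolute value this condition is equivalent to the Cauchy property.\<close>
abbreviation ncauchy :: "(nat \<Rightarrow> 'a::field fls alg_closure) \<Rightarrow> bool" where
  "ncauchy s \<equiv> (\<lambda>n. nrm (s (Suc n) - s n)) \<longlonglongrightarrow> 0"

lemma tendsto_0_le:
  fixes f g :: "nat \<Rightarrow> real"
  assumes "g \<longlonglongrightarrow> 0" "\<And>n. 0 \<le> f n" "\<And>n. f n \<le> g n"
  shows "f \<longlonglongrightarrow> 0"
  using assms by (intro tendsto_sandwich[OF _ _ tendsto_const assms(1)]) auto

lemma nrm_triangle: "nrm (x + y) \<le> nrm x + nrm y"
  using nrm_add[of x y] nrm_ge0[of x] nrm_ge0[of y] by linarith

lemma nrm_triangle_diff: "nrm (x - y) \<le> nrm x + nrm y"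
  using nrm_triangle[of x "- y"] by simp

lemma nrm_diff_triangle: "nrm (x - z) \<le> nrm (x - y) + nrm (y - z)"
  using nrm_triangle[of "x - y" "y - z"] by simp

lemma conv_add:
  assumes "conv s l" "conv t m" shows "conv (\<lambda>n. s n + t n) (l + m)"
proof (rule tendsto_0_le)
  show "(\<lambda>n. nrm (s n - l) + nrm (t n - m)) \<longlonglongrightarrow> 0" using tendsto_add[OF assms] by simp
  show "nrm (s n + t n - (l + m)) \<le> nrm (s n - l) + nrm (t n - m)" for n
    using nrm_triangle[of "s n - l" "t n - m"] by (simp add: algebra_simps)
qed auto

lemma conv_cmult:
  assumes "conv s l" shows "conv (\<lambda>n. c * s n) (c * l)"
  using tendsto_mult_left[OF assms, of "nrm c"] by (simp flip: right_diff_distrib)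

lemma conv_unique:
  assumes "conv s l" "conv s m" shows "l = m"
proof -
  have "(\<lambda>n. nrm (l - m)) \<longlonglongrightarrow> 0"
  proof (rule tendsto_0_le)
    show "(\<lambda>n. nrm (s n - l) + nrm (s n - m)) \<longlonglongrightarrow> 0" using tendsto_add[OF assms] by simp
    show "nrm (l - m) \<le> nrm (s n - l) + nrm (s n - m)" for n
      using nrm_diff_triangle[of l m "s n"] by (simp add: nrm_diff_commute)
  qed auto
  then show ?thesis by (simp add: LIMSEQ_const_iff)
qed

lemma conv_imp_ncauchy:
  assumes "conv s l" shows "ncauchy s"
proof (rule tendsto_0_le)
  show "(\<lambda>n. nrm (s (Suc n) - l) + nrm (s n - l)) \<longlonglongrightarrow> 0"
    using tendsto_add[OF LIMSEQ_Suc[OF assms] assms] by simp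
  show "nrm (s (Suc n) - s n) \<le> nrm (s (Suc n) - l) + nrm (s n - l)" for n
    using nrm_diff_triangle[of "s (Suc n)" "s n" l] by (simp add: nrm_diff_commute)
qed auto

lemma conv_nrm_le:
  assumes "conv s l" "\<And>n. nrm (s n) \<le> r" shows "nrm l \<le> r"
proof (rule LIMSEQ_le_const)
  show "(\<lambda>n. nrm (s n - l) + r) \<longlonglongrightarrow> r" using tendsto_add[OF assms(1) tendsto_const[of r]] by simp
  have "nrm l \<le> nrm (s n - l) + r" for n
    using nrm_triangle_diff[of "s n" "s n - l"] assms(2)[of n] by simp
  then show "\<exists>N. \<forall>n\<ge>N. nrm l \<le> nrm (s n - l) + r" by blast
qed

lemma nrm_to_ac_le_iff: "nrm (to_ac f) \<le> 2 powr (- of_int k) \<longleftrightarrow> (\<forall>j<k. fls_nth f j = 0)"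
proof (cases "f = 0")
  case False
  have "(\<forall>j<k. fls_nth f j = 0) \<longleftrightarrow> k \<le> fls_subdegree f"
    using False by (auto intro: fls_subdegree_geI)
  then show ?thesis using False by (simp add: nrm_to_ac)
qed auto

text \<open>By \<open>nrm_to_ac_le_iff\<close>, a sequence of series with vanishing increments has
  eventually constant coefficients in every degree.\<close>

lemma fls_complete:
  fixes c :: "nat \<Rightarrow> 'a::field fls"
  assumes "ncauchy (\<lambda>n. to_ac (c n))"
  obtains l where "conv (\<lambda>n. to_ac (c n)) (to_ac l)"
proof -
  have "\<forall>k::int. \<exists>M. \<forall>n\<ge>M. \<forall>j<k. fls_nth (c (Suc n)) j = fls_nth (c n) j"
  proof
    fix k :: int
    have "eventually (\<lambda>n. nrm (to_ac (c (Suc n)) - to_ac (c n)) < 2 powr (- of_int k)) sequentially"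
      by (rule order_tendstoD(2)[OF assms]) simp
    then obtain M where M: "\<And>n. n \<ge> M \<Longrightarrow> nrm (to_ac (c (Suc n) - c n)) < 2 powr (- of_int k)"
      by (auto simp: eventually_sequentially)
    have "\<forall>j<k. fls_nth (c (Suc n) - c n) j = 0" if "n \<ge> M" for n
      using less_imp_le[OF M[OF that]] unfolding nrm_to_ac_le_iff .
    then show "\<exists>M. \<forall>n\<ge>M. \<forall>j<k. fls_nth (c (Suc n)) j = fls_nth (c n) j"
      by (auto intro!: exI[of _ M])
  qed
  then obtain M where M: "\<And>k n j. n \<ge> M k \<Longrightarrow> j < k \<Longrightarrow> fls_nth (c (Suc n)) j = fls_nth (c n) j"
    by metis
  have stable: "fls_nth (c n) j = fls_nth (c (M k)) j" if "n \<ge> M k" "j < k" for n k j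
    using that(1) by (induction n rule: dec_induct) (use M that(2) in auto)
  define g where "g = (\<lambda>j. fls_nth (c (M (j + 1))) j)"
  have g: "g j = fls_nth (c n) j" if "n \<ge> M k" "j < k" for n j k
  proof -
    have "fls_nth (c (max n (M (j + 1)))) j = g j"
      unfolding g_def by (rule stable) auto
    moreover have "fls_nth (c (max n (M (j + 1)))) j = fls_nth (c (M k)) j"
      using that by (intro stable) auto
    ultimately show ?thesis using stable[OF that] by simp
  qed
  \<comment> \<open>In negative degrees the limit agrees with the single series
    \<open>c (M 0)\<close>, so it has only finitely many negative terms and is a Laurent
    series.\<close>
  have "g j = 0" if "j < min 0 (fls_subdegree (c (M 0)))" for j
    using g[of 0 "M 0" j] that by simp
  then have l: "fls_nth (Abs_fls g) j = g j" for j
    using nth_Abs_fls_lower_bound[of "min 0 (fls_subdegree (c (M 0)))" g] by blast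
  show thesis
  proof (rule that[of "Abs_fls g"], rule LIMSEQ_I)
    fix e :: real assume "e > 0"
    then obtain k :: nat where k: "(1/2) ^ k < e" using real_arch_pow_inv[of e "1/2"] by auto
    have e: "(1/2) ^ k = (2::real) powr (- of_int (int k))"
      by (simp add: powr_minus powr_realpow power_one_over inverse_eq_divide)
    have "nrm (to_ac (c n - Abs_fls g)) \<le> 2 powr (- of_int (int k))" if "n \<ge> M (int k)" for n
      unfolding nrm_to_ac_le_iff using g[OF that] by (auto simp: l)
    then show "\<exists>no. \<forall>n\<ge>no. norm (nrm (to_ac (c n) - to_ac (Abs_fls g)) - 0) < e"
      using k unfolding e by (intro exI[of _ "M (int k)"]) force
  qed
qed

section \<open>Finite-dimensional subspaces: completeness and bounded linear maps\<close>

definition subsp :: "'a::field fls alg_closure set \<Rightarrow> bool" where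
  "subsp S \<longleftrightarrow> 0 \<in> S \<and> (\<forall>x\<in>S. \<forall>y\<in>S. x + y \<in> S) \<and> (\<forall>c. \<forall>x\<in>S. to_ac c * x \<in> S)"

lemma subspD:
  assumes "subsp S"
  shows "0 \<in> S" "x \<in> S \<Longrightarrow> y \<in> S \<Longrightarrow> x + y \<in> S" "x \<in> S \<Longrightarrow> to_ac c * x \<in> S"
    "x \<in> S \<Longrightarrow> y \<in> S \<Longrightarrow> x - y \<in> S" "x \<in> S \<Longrightarrow> - x \<in> S"
proof -
  show *: "0 \<in> S" "\<And>x y. x \<in> S \<Longrightarrow> y \<in> S \<Longrightarrow> x + y \<in> S" "\<And>c x. x \<in> S \<Longrightarrow> to_ac c * x \<in> S"
    using assms by (auto simp: subsp_def)
  show **: "\<And>x. x \<in> S \<Longrightarrow> - x \<in> S"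
  proof -
    fix x assume "x \<in> S"
    from *(3)[OF this, of "- 1"] show "- x \<in> S" by simp
  qed
  show "x \<in> S \<Longrightarrow> y \<in> S \<Longrightarrow> x - y \<in> S" using *(2)[of x "- y"] ** by simp
qed

definition Kinf_linear_on :: "'a::field fls alg_closure set \<Rightarrow> ('a fls alg_closure \<Rightarrow> 'a fls alg_closure) \<Rightarrow> bool" where
  "Kinf_linear_on S f \<longleftrightarrow> (\<forall>x\<in>S. \<forall>y\<in>S. f (x + y) = f x + f y) \<and> (\<forall>c. \<forall>x\<in>S. f (to_ac c * x) = to_ac c * f x)"

definition ncomplete :: "'a::field fls alg_closure set \<Rightarrow> bool" where
  "ncomplete S \<longleftrightarrow> (\<forall>s. (\<forall>n. s n \<in> S) \<and> ncauchy s \<longrightarrow> (\<exists>l\<in>S. conv s l))"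

text \<open>Completeness keeps exponentials and logarithms inside an extension. The boundedness
  clause is meant for conjugation maps, which are linear but not yet known to respect
  \<open>nrm\<close>.\<close>

definition good :: "'a::field fls alg_closure set \<Rightarrow> bool" where
  "good S \<longleftrightarrow> subsp S \<and> ncomplete S \<and> (\<forall>f. Kinf_linear_on S f \<longrightarrow> (\<exists>C. \<forall>x\<in>S. nrm (f x) \<le> C * nrm x))"

text \<open>S is complete, hence closed, so a vector e outside S has positive distance d from S. The
  coefficient of e in a vector v is then bounded by |v| / d, which makes both coordinates continuous
  and transfers completeness and boundedness.\<close>

lemma good_extend:
  fixes S :: "'a::field fls alg_closure set"
  assumes "good S"
  shows "good {y + to_ac c * e |y c. y \<in> S}" (is "good ?E")
proof (cases "e \<in> S")
  case True
  have S: "subsp S" using assms by (simp add: good_def)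
  have "?E = S"
  proof
    show "?E \<subseteq> S" using subspD[OF S] True by auto
    show "S \<subseteq> ?E"
    proof
      fix x assume "x \<in> S"
      then have "x = x + to_ac 0 * e" by simp
      then show "x \<in> ?E" using \<open>x \<in> S\<close> by blast
    qed
  qed
  then show ?thesis using assms by simp
next
  case False
  have S: "subsp S" and comp: "\<And>s. (\<And>n. s n \<in> S) \<Longrightarrow> ncauchy s \<Longrightarrow> \<exists>l\<in>S. conv s l"
    and bdd: "\<And>f. Kinf_linear_on S f \<Longrightarrow> \<exists>C. \<forall>x\<in>S. nrm (f x) \<le> C * nrm x"
    using assms by (auto simp: good_def ncomplete_def)
  note Ss = subspD[OF S]
  have "\<exists>d>0. \<forall>y\<in>S. nrm (y - e) \<ge> d"
  proof (rule ccontr)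
    assume "\<not> ?thesis"
    then have "\<forall>n. \<exists>y\<in>S. nrm (y - e) < inverse (real (Suc n))" by (force simp: not_le)
    then obtain y where y: "\<And>n. y n \<in> S" "\<And>n. nrm (y n - e) < inverse (real (Suc n))" by metis
    have ce: "conv y e"
      by (rule tendsto_0_le[OF LIMSEQ_inverse_real_of_nat]) (use y(2) in \<open>auto intro: less_imp_le\<close>)
    then obtain l where "l \<in> S" "conv y l" using comp[OF y(1) conv_imp_ncauchy[OF ce]] by blast
    with False conv_unique[OF ce] show False by blast
  qed
  then obtain d where d: "d > 0" "\<And>y. y \<in> S \<Longrightarrow> nrm (y - e) \<ge> d" by blast
  have coord: "nrm (to_ac c) \<le> nrm (y + to_ac c * e) / d" if "y \<in> S" for y c
  proof (cases "c = 0")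
    case False
    have "y + to_ac c * e = - to_ac c * (to_ac (- inverse c) * y - e)"
      using False by (simp add: algebra_simps)
    then have "nrm (y + to_ac c * e) = nrm (to_ac c) * nrm (to_ac (- inverse c) * y - e)"
      by (simp only: nrm_mult nrm_minus)
    also have "\<dots> \<ge> nrm (to_ac c) * d"
      by (intro mult_left_mono d Ss that) auto
    finally show ?thesis using d(1) by (simp add: field_simps)
  qed (use d in auto)
  have sub: "subsp ?E"
    unfolding subsp_def
  proof (intro conjI ballI allI)
    show "0 \<in> ?E" using Ss(1) by (auto intro!: exI[of _ 0])
  next
    fix x y assume "x \<in> ?E" "y \<in> ?E"
    then obtain u c v b where *: "x = u + to_ac c * e" "y = v + to_ac b * e" "u \<in> S" "v \<in> S" by blast
    have "x + y = (u + v) + to_ac (c + b) * e" by (simp add: * algebra_simps)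
    then show "x + y \<in> ?E" using Ss(2) * by blast
  next
    fix c x assume "x \<in> ?E"
    then obtain u b where *: "x = u + to_ac b * e" "u \<in> S" by blast
    have "to_ac c * x = to_ac c * u + to_ac (c * b) * e" by (simp add: * algebra_simps)
    then show "to_ac c * x \<in> ?E" using Ss(3) * by blast
  qed
  moreover have "ncomplete ?E"
    unfolding ncomplete_def
  proof (intro allI impI, elim conjE)
    fix s assume sE: "\<forall>n. s n \<in> ?E" and cau: "ncauchy s"
    then have "\<forall>n. \<exists>y c. y \<in> S \<and> s n = y + to_ac c * e" by blast
    then obtain y c where yc: "\<And>n. y n \<in> S" "\<And>n. s n = y n + to_ac (c n) * e" by metis
    have diff: "s (Suc n) - s n = (y (Suc n) - y n) + to_ac (c (Suc n) - c n) * e" for n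
      by (simp add: yc algebra_simps)
    have cb: "nrm (to_ac (c (Suc n)) - to_ac (c n)) \<le> nrm (s (Suc n) - s n) / d" for n
      using coord[of "y (Suc n) - y n" "c (Suc n) - c n"] yc(1) Ss(4) unfolding diff by simp
    have cc: "ncauchy (\<lambda>n. to_ac (c n))"
      by (rule tendsto_0_le[OF _ _ cb]) (use tendsto_divide[OF cau tendsto_const[of d]] d(1) in auto)
    then obtain g where g: "conv (\<lambda>n. to_ac (c n)) (to_ac g)" by (rule fls_complete)
    have "ncauchy y"
    proof (rule tendsto_0_le)
      show "(\<lambda>n. nrm (s (Suc n) - s n) + nrm (to_ac (c (Suc n)) - to_ac (c n)) * nrm e) \<longlonglongrightarrow> 0"
        using tendsto_add[OF cau tendsto_mult_right[OF cc, of "nrm e"]] by simp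
      show "nrm (y (Suc n) - y n) \<le> nrm (s (Suc n) - s n) + nrm (to_ac (c (Suc n)) - to_ac (c n)) * nrm e" for n
      proof -
        have "y (Suc n) - y n = (s (Suc n) - s n) - (to_ac (c (Suc n)) - to_ac (c n)) * e"
          unfolding diff by simp
        then show ?thesis
          using nrm_triangle_diff[of "s (Suc n) - s n" "(to_ac (c (Suc n)) - to_ac (c n)) * e"] by simp
      qed
    qed auto
    then obtain l where l: "l \<in> S" "conv y l" using comp yc(1) by blast
    have "conv s (l + to_ac g * e)"
      using conv_add[OF l(2) conv_cmult[OF g, of e]] by (simp add: yc mult.commute)
    then show "\<exists>l\<in>?E. conv s l" using l(1) by blast
  qed
  moreover have "\<exists>C. \<forall>x\<in>?E. nrm (f x) \<le> C * nrm x" if f: "Kinf_linear_on ?E f" for f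
  proof -
    have eE: "e \<in> ?E" 
    proof -
      have "e = 0 + to_ac 1 * e" by simp
      then show ?thesis using Ss(1) by blast
    qed
    have SE: "y \<in> ?E" if "y \<in> S" for y
    proof -
      have "y = y + to_ac 0 * e" by simp
      then show ?thesis using that by blast
    qed
    have "Kinf_linear_on S f" using f SE unfolding Kinf_linear_on_def by blast
    then obtain C0 where C0: "\<And>x. x \<in> S \<Longrightarrow> nrm (f x) \<le> C0 * nrm x" using bdd by blast
    define C where "C = max C0 0"
    have C: "C \<ge> 0" "\<And>x. x \<in> S \<Longrightarrow> nrm (f x) \<le> C * nrm x"

    proof -
      show "C \<ge> 0" by (simp add: C_def)
      fix x assume "x \<in> S"
      then have "nrm (f x) \<le> C0 * nrm x" by (rule C0)
      also have "\<dots> \<le> C * nrm x" by (intro mult_right_mono) (auto simp: C_def)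
      finally show "nrm (f x) \<le> C * nrm x" .
    qed
    have "nrm (f x) \<le> (C * (1 + nrm e / d) + nrm (f e) / d) * nrm x" if xE: "x \<in> ?E" for x
    proof -
      obtain y c where yc: "x = y + to_ac c * e" "y \<in> S" using xE by blast
      have cx: "nrm (to_ac c) \<le> nrm x / d" using coord[OF yc(2)] yc(1) by simp
      have "nrm y \<le> nrm x + nrm (to_ac c) * nrm e"
        using nrm_triangle_diff[of x "to_ac c * e"] by (simp add: yc(1))
      also have "\<dots> \<le> nrm x + nrm x / d * nrm e"
        by (intro add_left_mono mult_right_mono cx) auto
      finally have y: "nrm y \<le> nrm x + nrm x / d * nrm e" .
      have "f x = f y + to_ac c * f e"
      proof -
        have "to_ac c * e \<in> ?E" using subspD(3)[OF sub eE] .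
        then have "f (y + to_ac c * e) = f y + f (to_ac c * e)"
          using f SE[OF yc(2)] unfolding Kinf_linear_on_def by blast
        also have "f (to_ac c * e) = to_ac c * f e"
          using f eE unfolding Kinf_linear_on_def by blast
        finally show ?thesis unfolding yc(1) .
      qed
      then have "nrm (f x) \<le> nrm (f y) + nrm (to_ac c) * nrm (f e)"
        using nrm_triangle[of "f y" "to_ac c * f e"] by simp
      also have "\<dots> \<le> C * (nrm x + nrm x / d * nrm e) + nrm x / d * nrm (f e)"
        by (rule add_mono[OF order_trans[OF C(2)[OF yc(2)] mult_left_mono[OF y C(1)]] mult_right_mono[OF cx nrm_ge0]])
      also have "\<dots> = (C * (1 + nrm e / d) + nrm (f e) / d) * nrm x" by (simp add: distrib_left distrib_right mult_ac)
      finally show ?thesis .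
    qed
    then show ?thesis by blast
  qed
  ultimately show ?thesis unfolding good_def by blast
qed

lemma good_zero: "good {0 :: 'a::field fls alg_closure}"
  unfolding good_def
proof (intro conjI allI impI)
  show "subsp {0 :: 'a fls alg_closure}" by (simp add: subsp_def)
  show "ncomplete {0 :: 'a fls alg_closure}" unfolding ncomplete_def by auto
  fix f :: "'a fls alg_closure \<Rightarrow> 'a fls alg_closure" assume "Kinf_linear_on {0} f"
  then have "f 0 = f 0 + f 0" unfolding Kinf_linear_on_def by (metis add_0 singletonI)
  then have "f 0 = 0" by (metis add_cancel_left_left)
  then show "\<exists>C. \<forall>x\<in>{0}. nrm (f x) \<le> C * nrm x" by simp
qed

text \<open>The span of the first n powers of x, one vector more with each n, so that
  \<open>good_extend\<close> drives an induction. Vanishing coefficients instead of a degree bound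
  give the zero space at n = 0.\<close>

definition pspan :: "'a::field alg_closure \<Rightarrow> nat \<Rightarrow> 'a alg_closure set" where
  "pspan x n = {ev p x |p. \<forall>i\<ge>n. coeff p i = 0}"

lemma pspan_Suc: "pspan x (Suc n) = {y + to_ac c * x ^ n |y c. y \<in> pspan x n}"
proof safe
  fix z assume "z \<in> pspan x (Suc n)"
  then obtain p where p: "z = ev p x" "\<forall>i\<ge>Suc n. coeff p i = 0" by (auto simp: pspan_def)
  have "z = ev (p - monom (coeff p n) n) x + to_ac (coeff p n) * x ^ n" by (simp add: p)
  moreover have "ev (p - monom (coeff p n) n) x \<in> pspan x n"
    unfolding pspan_def using p(2) by (auto intro!: exI[of _ "p - monom (coeff p n) n"] simp: not_less_eq_eq)
  ultimately show "\<exists>y c. z = y + to_ac c * x ^ n \<and> y \<in> pspan x n" by blast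
next
  fix y c assume "y \<in> pspan x n"
  then obtain p where p: "y = ev p x" "\<forall>i\<ge>n. coeff p i = 0" by (auto simp: pspan_def)
  have "y + to_ac c * x ^ n = ev (p + monom c n) x" by (simp add: p)
  moreover have "\<forall>i\<ge>Suc n. coeff (p + monom c n) i = 0" using p(2) by simp
  ultimately show "y + to_ac c * x ^ n \<in> pspan x (Suc n)" unfolding pspan_def by blast
qed

lemma good_pspan: "good (pspan x n)"
proof (induction n)
  case 0
  have "(\<forall>i\<ge>0. coeff p i = 0) \<longleftrightarrow> p = 0" for p :: "'a fls poly"
    using leading_coeff_0_iff[of p] by (metis coeff_0 zero_le)
  then have "pspan x 0 = {0}" by (simp add: pspan_def)
  then show ?case by (simp add: good_zero)
next
  case (Suc n)
  then show ?case unfolding pspan_Suc by (rule good_extend)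
qed

section \<open>Simple extensions \<open>K_\<infinity>(x)\<close> and minimal polynomials\<close>

definition adj :: "'a::field alg_closure \<Rightarrow> 'a alg_closure set" where
  "adj x = range (\<lambda>p. ev p x)"

lemma min_poly_props:
  fixes x :: "'a::{finite,field} fls alg_closure"
  shows lead_coeff_min_poly: "lead_coeff (min_poly x) = 1"
    and ev_min_poly: "ev (min_poly x) x = 0"
    and min_poly_minimal: "r \<noteq> 0 \<Longrightarrow> ev r x = 0 \<Longrightarrow> degree (min_poly x) \<le> degree r"
proof -
  define P where "P = (\<lambda>p :: 'a fls poly. p \<noteq> 0 \<and> ev p x = 0)"
  obtain p0 where "P p0" unfolding P_def using alg_closure_algebraic by metis
  then obtain p where p: "P p" "\<And>r. P r \<Longrightarrow> degree p \<le> degree r"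
    using ex_has_least_nat[of P p0 degree] by blast
  define m where "m = smult (inverse (lead_coeff p)) p"
  let ?Q = "\<lambda>p. lead_coeff p = 1 \<and> ev p x = 0 \<and> (\<forall>r. r \<noteq> 0 \<and> ev r x = 0 \<longrightarrow> degree p \<le> degree r)"
  have Qm: "?Q m" using p by (auto simp: m_def P_def)
  have uniq: "m' = m" if Q: "?Q m'" for m'
  proof (rule ccontr)
    assume ne: "m' \<noteq> m"
    have "m \<noteq> 0" "m' \<noteq> 0" using Qm Q by auto
    then have deg: "degree m' = degree m" using Qm Q by (meson order_antisym)
    have "degree m \<le> degree (m' - m)" using Qm Q ne by auto
    moreover have "coeff (m' - m) (degree m) = 0" using Qm Q deg by simp
    moreover have "degree (m' - m) \<le> degree m" using deg by (intro degree_diff_le) auto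
    ultimately show False using ne by (metis eq_iff_diff_eq_0 leading_coeff_0_iff order_antisym)
  qed
  have "min_poly x = m"
    unfolding min_poly_def by (rule the_equality) (use Qm in blast, use uniq in blast)
  then have "?Q (min_poly x)" using Qm by blast
  then show "lead_coeff (min_poly x) = 1" "ev (min_poly x) x = 0"
    "r \<noteq> 0 \<Longrightarrow> ev r x = 0 \<Longrightarrow> degree (min_poly x) \<le> degree r" by auto
qed

lemma min_poly_nz: "min_poly x \<noteq> 0"
  using lead_coeff_min_poly[of x] by auto

lemma degree_min_poly_pos: "degree (min_poly x) > 0"
proof (rule ccontr)
  assume "\<not> ?thesis"
  then obtain c where "min_poly x = [:c:]" by (metis degree_0_id gr0I)
  then show False using lead_coeff_min_poly[of x] ev_min_poly[of x] by simp
qed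

lemma min_poly_dvd_iff: "min_poly x dvd p \<longleftrightarrow> ev p x = 0"
proof
  assume "min_poly x dvd p"
  then show "ev p x = 0" by (auto elim!: dvdE simp: ev_min_poly)
next
  assume z: "ev p x = 0"
  have "ev (p mod min_poly x) x = 0"
    using z by (subst minus_div_mult_eq_mod[symmetric]) (simp add: ev_min_poly)
  moreover have "p mod min_poly x = 0 \<or> degree (p mod min_poly x) < degree (min_poly x)"
    by (rule degree_mod_less[OF min_poly_nz])
  ultimately have "p mod min_poly x = 0" using min_poly_minimal by force
  then show "min_poly x dvd p" by auto
qed

lemma adj_eq_pspan: "adj x = pspan x (degree (min_poly x))"
proof
  show "adj x \<subseteq> pspan x (degree (min_poly x))"
  proof
    fix z assume "z \<in> adj x"
    then obtain p where p: "z = ev p x" by (auto simp: adj_def)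
    have "z = ev (p - p div min_poly x * min_poly x) x" by (simp add: p ev_min_poly)
    then have "z = ev (p mod min_poly x) x" by (simp only: minus_div_mult_eq_mod)
    moreover have "coeff (p mod min_poly x) i = 0" if "i \<ge> degree (min_poly x)" for i
      using degree_mod_less[OF min_poly_nz[of x], of p] that by (auto intro: coeff_eq_0)
    ultimately show "z \<in> pspan x (degree (min_poly x))" by (auto simp: pspan_def)
  qed
qed (auto simp: adj_def pspan_def)

lemma good_adj: "good (adj (x :: 'a::{finite,field} fls alg_closure))"
  unfolding adj_eq_pspan by (rule good_pspan)

lemma adj_complete:
  fixes x :: "'a::{finite,field} fls alg_closure"
  assumes "\<And>n. s n \<in> adj x" "ncauchy s"
  obtains l where "l \<in> adj x" "conv s l"
  using good_adj[of x] assms unfolding good_def ncomplete_def by blast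

lemma to_ac_in_adj: "to_ac c \<in> adj x"
  unfolding adj_def by (auto intro!: image_eqI[of _ _ "[:c:]"])

lemma self_in_adj: "x \<in> adj x"
  unfolding adj_def by (auto intro!: image_eqI[of _ _ "[:0,1:]"])

text \<open>The minimal polynomial of z has the form c + T p'(T), and minimality forces c to be
  nonzero if z is. Then z p'(z) = - c exhibits 1/z as a polynomial in z, hence in x.\<close>

lemma adj_inverse:
  fixes x :: "'a::{finite,field} fls alg_closure"
  assumes "z \<in> adj x" shows "inverse z \<in> adj x"
proof (cases "z = 0")
  case False
  obtain c p' where cp: "min_poly z = pCons c p'" by (cases "min_poly z")
  have "c \<noteq> 0"
  proof
    assume "c = 0"
    then have "z * ev p' z = 0" using ev_min_poly[of z] cp by simp
    then have "ev p' z = 0" using False by simp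
    moreover have "p' \<noteq> 0" using cp min_poly_nz[of z] \<open>c = 0\<close> by auto
    ultimately have "degree (min_poly z) \<le> degree p'" by (intro min_poly_minimal) auto
    then show False using cp \<open>p' \<noteq> 0\<close> by simp
  qed
  have "z * ev p' z = - to_ac c" using ev_min_poly[of z] cp by (simp add: eq_neg_iff_add_eq_0 add.commute)
  then have "inverse z = to_ac (- inverse c) * ev p' z"
    using False \<open>c \<noteq> 0\<close> by (simp add: field_simps)
  also have "\<dots> = ev (smult (- inverse c) p') z" by simp
  finally have "inverse z = ev (smult (- inverse c) p') z" .
  moreover obtain r where "z = ev r x" using assms by (auto simp: adj_def)
  ultimately have "inverse z = ev (pcompose (smult (- inverse c) p') r) x" by (simp only: ev_pcompose)
  then show ?thesis unfolding adj_def by (rule range_eqI)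
qed (use to_ac_in_adj[of 0] in simp)

lemma adj_subring: "is_subring (adj x)"
  unfolding is_subring_def adj_def
  by (auto intro: image_eqI[of _ _ 1] image_eqI[of _ _ "p - r" for p r] image_eqI[of _ _ "p * r" for p r]
      simp flip: ev_diff ev_mult)

text \<open>If p(x) is nonzero, its inverse is r(x) for some r. Then p r - 1 vanishes at x,
  therefore at x', and p(x') cannot be zero.\<close>

lemma ev_conjugate_eq_0_iff:
  fixes x :: "'a::{finite,field} fls alg_closure"
  assumes "ev (min_poly x) x' = 0"
  shows "ev p x' = 0 \<longleftrightarrow> ev p x = 0"
proof
  have *: "ev p x = 0 \<Longrightarrow> ev p x' = 0" for p
    using assms by (auto elim!: dvdE simp flip: min_poly_dvd_iff[of x])
  show "ev p x = 0 \<Longrightarrow> ev p x' = 0" by (rule *)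
  assume z: "ev p x' = 0"
  show "ev p x = 0"
  proof (rule ccontr)
    assume nz: "ev p x \<noteq> 0"
    have "inverse (ev p x) \<in> adj x" by (rule adj_inverse) (auto simp: adj_def)
    then obtain r where "inverse (ev p x) = ev r x" by (auto simp: adj_def)
    then have "ev (p * r - 1) x = 0" using nz by (metis ev_1 ev_diff ev_mult right_inverse diff_self)
    then have "ev (p * r - 1) x' = 0" by (rule *)
    then show False using z by simp
  qed
qed

section \<open>Conjugate elements and the comparison with \<open>vL\<close>\<close>

lemma nrm_conjugate_le:
  fixes x y :: "'a::{finite,field} fls alg_closure"
  assumes xy: "\<And>p. ev p x = 0 \<longleftrightarrow> ev p y = 0"
  shows "nrm y \<le> nrm x"
proof -
  have x0: "x = 0 \<longleftrightarrow> y = 0" using xy[of "[:0,1:]"] by simp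
  \<comment> \<open>The conjugation p(x) \<mapsto> p(y); by \<open>xy\<close> its value does not
    depend on the polynomial that \<open>SOME\<close> picks.\<close>
  define f where "f = (\<lambda>z. ev (SOME p. z = ev p x) y)"
  have f: "f (ev p x) = ev p y" for p
  proof -
    have "ev p x = ev (SOME r. ev p x = ev r x) x" by (rule someI[of _ p]) simp
    then have "ev (p - (SOME r. ev p x = ev r x)) x = 0" by simp
    then have "ev (p - (SOME r. ev p x = ev r x)) y = 0" unfolding xy .
    then show ?thesis by (simp add: f_def)
  qed
  have "Kinf_linear_on (adj x) f"
    unfolding Kinf_linear_on_def adj_def by (auto simp: f simp flip: ev_add ev_smult)
  then obtain C where C: "\<And>z. z \<in> adj x \<Longrightarrow> nrm (f z) \<le> C * nrm z"
    using good_adj[of x] unfolding good_def by blast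
  \<comment> \<open>The bound C is the same for all powers of x, so letting k grow removes
    it.\<close>
  have pow: "nrm y ^ k \<le> C * nrm x ^ k" for k
  proof -
    have "ev (monom 1 k) x \<in> adj x" unfolding adj_def by (rule rangeI)
    from C[OF this] show ?thesis unfolding f by simp
  qed
  show ?thesis
  proof (rule ccontr)
    assume n: "\<not> nrm y \<le> nrm x"
    then have "x \<noteq> 0" using x0 by auto
    then have xp: "nrm x > 0" by simp
    then have "nrm y / nrm x > 1" using n by simp
    then obtain k where "C < (nrm y / nrm x) ^ k" using real_arch_pow by blast
    then have "C * nrm x ^ k < nrm y ^ k" using xp by (simp add: power_divide field_simps)
    then show False using pow[of k] by simp
  qed
qed

lemma nrm_conjugate:
  fixes x x' :: "'a::{finite,field} fls alg_closure"
  assumes "ev (min_poly x) x' = 0" shows "nrm x' = nrm x"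
  using nrm_conjugate_le[of x x'] nrm_conjugate_le[of x' x] ev_conjugate_eq_0_iff[OF assms]
  by (metis order_antisym)

text \<open>Up to sign, the constant coefficient of the minimal polynomial is the product of its n
  roots, and all roots have the same \<open>nrm\<close>. The roots form a multiset, so inseparable
  minimal polynomials are covered.\<close>

lemma vL_eq_nrm:
  fixes x :: "'a::{finite,field} fls alg_closure"
  assumes "x \<noteq> 0" shows "vL x = ereal (- log 2 (nrm x))"
proof -
  define m where "m = min_poly x"
  define n where "n = degree m"
  define M where "M = map_poly (to_ac :: 'a fls \<Rightarrow> _) m"
  have n0: "n > 0" using degree_min_poly_pos by (simp add: n_def m_def)
  have "M \<noteq> 0" "degree M = n" "lead_coeff M = 1"
    using lead_coeff_min_poly[of x] min_poly_nz[of x]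
    by (auto simp: M_def n_def m_def degree_map_poly coeff_map_poly map_poly_eq_0_iff)
  then obtain A where A: "size A = n" "M = (\<Prod>a\<in>#A. [:- a, 1:])"
    using alg_closed_imp_factorization[of M] by auto
  have root: "nrm a = nrm x" if "a \<in># A" for a
  proof -
    have "poly M a = 0" using that unfolding A(2) poly_prod_mset by (force simp: prod_mset_zero_iff)
    then show ?thesis by (intro nrm_conjugate) (simp add: M_def m_def)
  qed
  have "to_ac (coeff m 0) = poly M 0" by (simp add: M_def poly_0_coeff_0 coeff_map_poly)
  also have "\<dots> = (\<Prod>a\<in>#A. - a)" unfolding A(2) poly_prod_mset by (simp add: image_mset.compositionality o_def)
  finally have "nrm (to_ac (coeff m 0)) = nrm (\<Prod>a\<in>#A. - a)" by simp
  also have "\<dots> = nrm x ^ size A"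
    using root by (induction A) auto
  finally have e: "nrm (to_ac (coeff m 0)) = nrm x ^ n" by (simp add: A(1))
  then have "coeff m 0 \<noteq> 0" using assms by (metis nrm_eq_0 power_not_zero to_ac_0)
  then have "2 powr (- of_int (fls_subdegree (coeff m 0))) = nrm x ^ n" using e by (simp add: nrm_to_ac)
  then have "log 2 (2 powr (- of_int (fls_subdegree (coeff m 0)))) = log 2 (nrm x ^ n)" by simp
  then have "- of_int (fls_subdegree (coeff m 0)) = n * log 2 (nrm x)"
    using assms by (simp add: log_nat_power)
  then have "of_int (fls_subdegree (coeff m 0)) / real n = - log 2 (nrm x)"
    using n0 by (simp add: field_simps)
  then show ?thesis using assms by (simp add: vL_def m_def n_def)
qed

lemma vL_tendsto_iff:
  fixes s :: "nat \<Rightarrow> 'a::{finite,field} fls alg_closure"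
  shows "((\<lambda>n. vL (s n)) \<longlongrightarrow> PInfty) sequentially \<longleftrightarrow> conv s 0"
proof -
  have iff: "ereal r < vL x \<longleftrightarrow> nrm x < 2 powr (- r)" for r and x :: "'a fls alg_closure"
  proof (cases "x = 0")
    case False
    then have "ereal r < vL x \<longleftrightarrow> log 2 (nrm x) < - r" by (auto simp: vL_eq_nrm)
    also have "\<dots> \<longleftrightarrow> nrm x < 2 powr (- r)" using False by (subst log_less_iff) auto
    finally show ?thesis .
  qed (simp add: vL_def)
  have "((\<lambda>n. vL (s n)) \<longlongrightarrow> \<infinity>) sequentially \<longleftrightarrow> (\<forall>r. eventually (\<lambda>n. nrm (s n) < 2 powr (- r)) sequentially)"
    unfolding tendsto_PInfty iff ..
  also have "\<dots> \<longleftrightarrow> conv s 0"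
  proof
    assume c: "conv s 0"
    show "\<forall>r. eventually (\<lambda>n. nrm (s n) < 2 powr (- r)) sequentially"
      using order_tendstoD(2)[OF c] by simp
  next
    assume r: "\<forall>r. eventually (\<lambda>n. nrm (s n) < 2 powr (- r)) sequentially"
    show "conv s 0"
    proof (rule order_tendstoI)
      fix a :: real assume "0 < a"
      then show "eventually (\<lambda>n. nrm (s n - 0) < a) sequentially"
        using r[rule_format, of "- log 2 a"] by simp
    next
      fix a :: real assume "a < 0"
      then show "eventually (\<lambda>n. a < nrm (s n - 0)) sequentially"
        by (intro always_eventually) (auto intro: less_le_trans)
    qed
  qed
  finally show ?thesis by simp
qed

section \<open>The exponential and its periods\<close>

lemma card_ge_2: "CARD('a::{finite,field}) \<ge> 2"
proof -
  have "card {0, 1 :: 'a} \<le> CARD('a)" by (intro card_mono) auto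
  then show ?thesis by simp
qed

lemma power_card_eq_self: "(c :: 'a::{finite,field}) ^ CARD('a) = c"
proof (cases "c = 0")
  case False
  have "(\<Prod>y\<in>UNIV-{0}. y) = (\<Prod>y\<in>UNIV-{0}. c * y)"
    by (rule prod.reindex_bij_witness[of _ "\<lambda>y. c * y" "\<lambda>y. y / c"]) (use False in auto)
  also have "\<dots> = c ^ (CARD('a) - 1) * (\<Prod>y\<in>UNIV-{0}. y)"
    by (simp add: prod.distrib card_Diff_singleton)
  finally have "c ^ (CARD('a) - 1) = 1" by simp
  then have "c * c ^ (CARD('a) - 1) = c" by simp
  then show ?thesis by (simp add: power_eq_if)
qed (use card_ge_2[where 'a = 'a] in simp)

abbreviation fconst :: "'a::{finite,field} \<Rightarrow> 'a fls alg_closure" where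
  "fconst c \<equiv> to_ac (fls_const c)"

lemma fconst_power_card: "fconst (c :: 'a::{finite,field}) ^ CARD('a) = fconst c"
  unfolding to_ac_power[symmetric] fls_const_power[symmetric] power_card_eq_self ..

lemma fconst_add: "fconst (c + d) = fconst c + fconst d"
  by (simp add: fls_plus_const flip: to_ac_add)

lemma inj_fconst: "inj fconst"
  by (rule injI) (metis fls_const_nth to_ac_eq_iff)

lemma monic_degree_linear_power: "degree ([:c, 1:] ^ n) = n" "coeff ([:c, 1:] ^ n) n = (1 :: 'b::field)"
  using lead_coeff_power[of "[:c, 1:]" n] by (simp_all add: degree_power_eq)

text \<open>Two applications of the identity theorem on the \<open>q\<close> points of \<open>F_q\<close>: first for
  \<open>(T + c)^q = T^q + c\<close> with \<open>c\<close> in \<open>F_q\<close>, then for \<open>(T + x)^q = T^q + x^q\<close>.\<close>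
lemma frobenius_add:
  fixes x y :: "'a::{finite,field} fls alg_closure"
  shows "(x + y) ^ CARD('a) = x ^ CARD('a) + y ^ CARD('a)"
proof -
  let ?q = "CARD('a)"
  have q0: "?q > 0" by simp
  have step: "[:u, 1:] ^ ?q = monom 1 ?q + [:u ^ ?q:]"
    if "\<And>c. (fconst c + u) ^ ?q = fconst (c :: 'a) + u ^ ?q" for u
  proof (rule poly_eqI_degree_lead_coeff[where A = "range (fconst :: 'a \<Rightarrow> _)" and n = ?q])
    show "card (range (fconst :: 'a \<Rightarrow> _)) \<ge> ?q" by (subst card_image[OF inj_fconst]) simp
    show "degree (monom 1 ?q + [:u ^ ?q:]) \<le> ?q" by (intro degree_add_le degree_monom_le) auto
    show "coeff ([:u, 1:] ^ ?q) ?q = coeff (monom 1 ?q + [:u ^ ?q:]) ?q"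
      using q0 by (simp add: monic_degree_linear_power coeff_pCons split: nat.split)
    fix z assume "z \<in> range (fconst :: 'a \<Rightarrow> _)"
    then show "poly ([:u, 1:] ^ ?q) z = poly (monom 1 ?q + [:u ^ ?q:]) z"
      using that by (auto simp: poly_monom fconst_power_card add.commute)
  qed (simp add: monic_degree_linear_power)
  have 1: "(z + fconst c) ^ ?q = z ^ ?q + fconst c" for z and c :: 'a
  proof -
    have "[:fconst c, 1:] ^ ?q = monom 1 ?q + [:fconst c ^ ?q:]"
      by (rule step) (simp add: fconst_power_card flip: fconst_add)
    then have "poly ([:fconst c, 1:] ^ ?q) z = poly (monom 1 ?q + [:fconst c ^ ?q:]) z" by simp
    then show ?thesis by (simp add: poly_monom fconst_power_card add.commute)
  qed
  have "[:y, 1:] ^ ?q = monom 1 ?q + [:y ^ ?q:]"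
    by (rule step) (use 1 in \<open>simp add: add.commute\<close>)
  then have "poly ([:y, 1:] ^ ?q) x = poly (monom 1 ?q + [:y ^ ?q:]) x" by simp
  then show ?thesis by (simp add: poly_monom add.commute)
qed

lemma frobenius_add_power:
  fixes x y :: "'a::{finite,field} fls alg_closure"
  shows "(x + y) ^ (CARD('a) ^ k) = x ^ (CARD('a) ^ k) + y ^ (CARD('a) ^ k)"
proof (induction k)
  case (Suc k)
  have "z ^ (CARD('a) ^ Suc k) = (z ^ (CARD('a) ^ k)) ^ CARD('a)" for z :: "'a fls alg_closure"
    by (simp add: mult.commute flip: power_mult)
  then show ?case by (simp add: Suc frobenius_add)
qed auto

lemma frobenius_diff_power:
  fixes x y :: "'a::{finite,field} fls alg_closure"
  shows "(x - y) ^ (CARD('a) ^ k) = x ^ (CARD('a) ^ k) - y ^ (CARD('a) ^ k)"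
  using frobenius_add_power[of "x - y" y k] by simp

lemma conv_frobenius:
  fixes s :: "nat \<Rightarrow> 'a::{finite,field} fls alg_closure"
  assumes "conv s l" shows "conv (\<lambda>n. s n ^ (CARD('a) ^ k)) (l ^ (CARD('a) ^ k))"
  using tendsto_power[OF assms, of "CARD('a) ^ k"]
  by (simp only: frobenius_diff_power[symmetric] nrm_power) (simp add: power_0_left)

lemma nrm_diff_eq:
  assumes "nrm y < nrm x" shows "nrm (x - y) = nrm x"
  using nrm_add[of "x - y" y] nrm_diff_le[of x "nrm x" y] assms by simp

lemmas adjD = is_subringD[OF adj_subring] is_subring_sum[OF adj_subring]

section \<open>Partial sums of the exponential and its functional equation\<close>

locale drinfeld_module =
  fixes a1 a2 :: "'a::{finite,field} fls" and q :: nat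
  assumes q_card: "q = CARD('a)"
begin

abbreviation \<phi> :: "'a fls alg_closure \<Rightarrow> 'a fls alg_closure" where "\<phi> \<equiv> phi_theta a1 a2"

lemma \<phi>_def: "\<phi> x = \<Theta> * x + to_ac a1 * x ^ q + to_ac a2 * x ^ (q ^ 2)"
  by (simp add: phi_theta_def q_card)

definition \<alpha> :: "nat \<Rightarrow> 'a fls alg_closure" where "\<alpha> i = to_ac (exp_coeff a1 a2 i)"

definition exp_sum :: "'a fls alg_closure \<Rightarrow> nat \<Rightarrow> 'a fls alg_closure" where
  "exp_sum z n = (\<Sum>i\<le>n. \<alpha> i * z ^ (q ^ i))"

text \<open>A relation, since the algebraic closure is not complete and a limit has to be found in a
  suitable \<open>adj y\<close> first.\<close>

definition has_exp :: "'a fls alg_closure \<Rightarrow> 'a fls alg_closure \<Rightarrow> bool" where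
  "has_exp z l \<longleftrightarrow> conv (exp_sum z) l"

lemma q_ge_2: "q \<ge> 2" unfolding q_card by (rule card_ge_2)

lemma frob_add: "((x :: 'a fls alg_closure) + y) ^ q = x ^ q + y ^ q"
  unfolding q_card by (rule frobenius_add)

lemma frob_add_power: "((x :: 'a fls alg_closure) + y) ^ (q ^ k) = x ^ (q ^ k) + y ^ (q ^ k)"
  unfolding q_card by (rule frobenius_add_power)

lemma frob_diff_power: "((x :: 'a fls alg_closure) - y) ^ (q ^ k) = x ^ (q ^ k) - y ^ (q ^ k)"
  unfolding q_card by (rule frobenius_diff_power)

lemma conv_frob: "conv s l \<Longrightarrow> conv (\<lambda>n. (s n :: 'a fls alg_closure) ^ (q ^ k)) (l ^ (q ^ k))"
  unfolding q_card by (rule conv_frobenius)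

lemma theta_power_diff:
  assumes "m \<ge> 2" shows "nrm (\<Theta> ^ m - \<Theta> :: 'a fls alg_closure) = 2 ^ m"
proof -
  have "(2::real) ^ 1 < 2 ^ m" using assms by (intro power_strict_increasing) auto
  then show ?thesis by (subst nrm_diff_eq) auto
qed

lemma q_power_ge: "q ^ Suc n \<ge> Suc (Suc n)"
proof (induction n)
  case (Suc n)
  have "Suc (Suc (Suc n)) \<le> 2 * q ^ Suc n" using Suc by simp
  also have "\<dots> \<le> q * q ^ Suc n" using q_ge_2 by (rule mult_right_mono) simp
  finally show ?case by simp
qed (use q_ge_2 in simp)

lemma theta_power_q_nz: "\<Theta> ^ (q ^ Suc n) - \<Theta> \<noteq> (0 :: 'a fls alg_closure)"
proof -
  have "q ^ Suc n \<ge> 2" using q_power_ge[of n] by simp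
  from theta_power_diff[OF this] show ?thesis by (metis nrm_0 power_not_zero zero_neq_numeral)
qed

lemma \<alpha>_0: "\<alpha> 0 = 1" by (simp add: \<alpha>_def)

lemma \<alpha>_1: "\<alpha> (Suc 0) * (\<Theta> ^ q - \<Theta>) = to_ac a1"
  using theta_power_q_nz[of 0] by (simp add: \<alpha>_def q_card)

lemma \<alpha>_Suc_Suc:
  "\<alpha> (Suc (Suc n)) * (\<Theta> ^ (q ^ Suc (Suc n)) - \<Theta>) = to_ac a1 * \<alpha> (Suc n) ^ q + to_ac a2 * \<alpha> n ^ (q ^ 2)"
  using theta_power_q_nz[of "Suc n"] by (simp add: \<alpha>_def q_card del: power_Suc)

lemma exp_sum_Suc: "exp_sum z (Suc n) = exp_sum z n + \<alpha> (Suc n) * z ^ (q ^ Suc n)"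
  by (simp add: exp_sum_def)

lemma exp_sum_0: "exp_sum z 0 = z" by (simp add: exp_sum_def \<alpha>_0)

text \<open>The functional equation holds exactly for partial sums once the truncations are shifted:
  \<tau> and \<tau>^2 raise the index of a term by 1 and 2, so the sums inside them stop one and two
  terms earlier.\<close>

lemma exp_sum_theta:
  "exp_sum (\<Theta> * z) (Suc (Suc n)) = \<Theta> * exp_sum z (Suc (Suc n)) + to_ac a1 * exp_sum z (Suc n) ^ q
     + to_ac a2 * exp_sum z n ^ (q ^ 2)"
proof (induction n)
  case 0
  have z2: "(z ^ q) ^ q = z ^ (q * q)" by (simp flip: power_mult)
  have 1: "\<Theta> ^ q * \<alpha> (Suc 0) = \<Theta> * \<alpha> (Suc 0) + to_ac a1"
    using \<alpha>_1 by (simp add: algebra_simps)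
  have 2: "\<Theta> ^ (q * q) * \<alpha> (Suc (Suc 0)) = \<Theta> * \<alpha> (Suc (Suc 0)) + (to_ac a1 * \<alpha> (Suc 0) ^ q + to_ac a2)"
    using \<alpha>_Suc_Suc[of 0] by (simp add: \<alpha>_0 algebra_simps)
  have "exp_sum (\<Theta> * z) (Suc (Suc 0)) = \<Theta> * z + (\<Theta> ^ q * \<alpha> (Suc 0)) * z ^ q + (\<Theta> ^ (q * q) * \<alpha> (Suc (Suc 0))) * z ^ (q * q)"
    by (simp add: exp_sum_Suc exp_sum_0 power_mult_distrib mult_ac)
  also have "\<dots> = \<Theta> * exp_sum z (Suc (Suc 0)) + to_ac a1 * exp_sum z (Suc 0) ^ q + to_ac a2 * exp_sum z 0 ^ (q ^ 2)"
    unfolding 1 2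
    by (simp add: exp_sum_Suc exp_sum_0 frob_add power_mult_distrib z2 power2_eq_square algebra_simps)
  finally show ?case .
next
  case (Suc n)
  let ?N = "Suc (Suc (Suc n))"
  have z1: "(z ^ (q ^ Suc (Suc n))) ^ q = z ^ (q ^ ?N)" and z2: "(z ^ (q ^ Suc n)) ^ (q ^ 2) = z ^ (q ^ ?N)"
    by (simp_all add: power2_eq_square mult_ac flip: power_mult)
  have 2: "\<Theta> ^ (q ^ ?N) * \<alpha> ?N = \<Theta> * \<alpha> ?N + (to_ac a1 * \<alpha> (Suc (Suc n)) ^ q + to_ac a2 * \<alpha> (Suc n) ^ (q ^ 2))"
    using \<alpha>_Suc_Suc[of "Suc n"] by (simp add: algebra_simps del: power_Suc)
  have "exp_sum (\<Theta> * z) ?N = exp_sum (\<Theta> * z) (Suc (Suc n)) + (\<Theta> ^ (q ^ ?N) * \<alpha> ?N) * z ^ (q ^ ?N)"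
    by (subst exp_sum_Suc) (simp only: power_mult_distrib mult_ac)
  also have "\<dots> = \<Theta> * (exp_sum z (Suc (Suc n)) + \<alpha> ?N * z ^ (q ^ ?N))
      + to_ac a1 * (exp_sum z (Suc n) ^ q + (\<alpha> (Suc (Suc n)) * z ^ (q ^ Suc (Suc n))) ^ q)
      + to_ac a2 * (exp_sum z n ^ (q ^ 2) + (\<alpha> (Suc n) * z ^ (q ^ Suc n)) ^ (q ^ 2))"
    unfolding Suc 2 power_mult_distrib z1 z2 by (simp only: distrib_left distrib_right ac_simps)
  also have "\<dots> = \<Theta> * exp_sum z ?N + to_ac a1 * exp_sum z (Suc (Suc n)) ^ q + to_ac a2 * exp_sum z (Suc n) ^ (q ^ 2)"
    by (simp only: exp_sum_Suc[of z "Suc (Suc n)"] exp_sum_Suc[of z "Suc n"] exp_sum_Suc[of z n]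
        frob_add frob_add_power)
  finally show ?case .
qed

lemma has_exp_theta:
  assumes "has_exp z l" shows "has_exp (\<Theta> * z) (\<phi> l)"
proof -
  have c: "conv (exp_sum z) l" using assms by (simp add: has_exp_def)
  have "conv (\<lambda>n. \<Theta> * exp_sum z (n + 2) + to_ac a1 * exp_sum z (n + 1) ^ (q ^ 1) + to_ac a2 * exp_sum z n ^ (q ^ 2))
     (\<Theta> * l + to_ac a1 * l ^ (q ^ 1) + to_ac a2 * l ^ (q ^ 2))"
    by (intro conv_add conv_cmult conv_frob c LIMSEQ_ignore_initial_segment[OF c])
  then have "conv (\<lambda>n. exp_sum (\<Theta> * z) (n + 2)) (\<phi> l)"
    by (simp add: exp_sum_theta \<phi>_def)
  then have "conv (exp_sum (\<Theta> * z)) (\<phi> l)"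
    by (rule LIMSEQ_offset)
  then show ?thesis by (simp add: has_exp_def)
qed

lemma exp_sum_diff: "exp_sum (z - w) n = exp_sum z n - exp_sum w n"
  by (simp add: exp_sum_def frob_diff_power right_diff_distrib sum_subtractf)

lemma has_exp_diff: "has_exp z l \<Longrightarrow> has_exp w m \<Longrightarrow> has_exp (z - w) (l - m)"
proof -
  assume "has_exp z l" "has_exp w m"
  then have "conv (\<lambda>n. exp_sum z n + (- 1) * exp_sum w n) (l + (- 1) * m)"
    unfolding has_exp_def by (intro conv_add conv_cmult)
  then show ?thesis by (simp add: has_exp_def exp_sum_diff[abs_def])
qed

lemma has_exp_unique: "has_exp z l \<Longrightarrow> has_exp z m \<Longrightarrow> l = m"
  unfolding has_exp_def by (rule conv_unique)

lemma period_lattice_iff: "z \<in> period_lattice a1 a2 \<longleftrightarrow> has_exp z 0"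
  unfolding period_lattice_def has_exp_def mem_Collect_eq vL_tendsto_iff exp_sum_def \<alpha>_def q_card[symmetric] ..

lemma exp_sum_in_adj: "z \<in> adj y \<Longrightarrow> exp_sum z n \<in> adj y"
  unfolding exp_sum_def by (intro adjD) (auto simp: \<alpha>_def to_ac_in_adj intro: adjD)

lemma \<phi>_in_adj: "z \<in> adj y \<Longrightarrow> \<phi> z \<in> adj y"
  unfolding \<phi>_def by (intro adjD(5,6) to_ac_in_adj) (auto intro: adjD(7))

end

text \<open>\<open>R\<close> is the absolute value of the nonzero \<open>\<theta>\<close>-torsion points: the valuation hypothesis
  of the theorem says that the Newton polygon of \<open>\<phi>\<^sub>\<theta>\<close> has a single slope.\<close>
locale one_slope_drinfeld_module = drinfeld_module +
  fixes R :: real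
  assumes R_pos: "R > 0"
    and a1_le: "nrm (to_ac a1) * R ^ q \<le> 2 * R"
    and a2_eq: "nrm (to_ac a2) * R ^ (q ^ 2) = 2 * R"
begin

text \<open>In the recursion, \<open>a1_le\<close> and \<open>a2_eq\<close> bound both numerator
  terms by 2R / R^(q^i), while the denominator has absolute value 2^(q^i), which is at least
  2^(i+1). This surplus produces the geometric decay.\<close>

lemma coeff_bound: "nrm (\<alpha> i) * R ^ (q ^ i) \<le> R * (1/2) ^ i"
proof (induction i rule: less_induct)
  case (less i)
  have half: "2 * R / 2 ^ (q ^ Suc m) \<le> R * (1/2) ^ Suc m" for m
  proof -
    have "(2::real) ^ Suc (Suc m) \<le> 2 ^ (q ^ Suc m)" using q_power_ge by (intro power_increasing) auto
    then have "2 * R / 2 ^ (q ^ Suc m) \<le> 2 * R / 2 ^ Suc (Suc m)" using R_pos by (intro divide_left_mono) auto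
    also have "\<dots> = R * (1/2) ^ Suc m" by (simp add: power_one_over field_simps)
    finally show ?thesis .
  qed
  have le_R: "nrm (\<alpha> j) * R ^ (q ^ j) \<le> R" if "j < i" for j
  proof -
    have "R * (1/2) ^ j \<le> R * 1" using R_pos by (intro mult_left_mono) (auto intro: power_le_one)
    with less[OF that] show ?thesis by simp
  qed
  consider "i = 0" | "i = Suc 0" | n where "i = Suc (Suc n)" by (metis not0_implies_Suc)
  then show ?case
  proof cases
    case 1
    then show ?thesis using R_pos by (simp add: \<alpha>_0)
  next
    case 2
    have "nrm (\<alpha> (Suc 0)) * 2 ^ q = nrm (to_ac a1)"
      using arg_cong[OF \<alpha>_1, of nrm] theta_power_diff[OF q_ge_2] by simp
    then have "nrm (\<alpha> (Suc 0)) * R ^ (q ^ Suc 0) = (nrm (to_ac a1) * R ^ q) / 2 ^ (q ^ Suc 0)"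
      by (simp add: field_simps)
    also have "\<dots> \<le> 2 * R / 2 ^ (q ^ Suc 0)" by (intro divide_right_mono a1_le) auto
    also note half
    finally show ?thesis using 2 by simp
  next
    case (3 n)
    let ?Q = "q ^ Suc (Suc n)"
    have Q2: "?Q \<ge> 2" using q_power_ge[of "Suc n"] by simp
    have R1: "R ^ ?Q = (R ^ (q ^ Suc n)) ^ q" and R2: "R ^ ?Q = (R ^ (q ^ n)) ^ (q ^ 2)"
      by (simp_all add: power2_eq_square mult_ac flip: power_mult)
    have "nrm (to_ac a1 * \<alpha> (Suc n) ^ q) * R ^ ?Q = nrm (to_ac a1) * (nrm (\<alpha> (Suc n)) * R ^ (q ^ Suc n)) ^ q"
      unfolding R1 power_mult_distrib by simp
    also have "\<dots> \<le> nrm (to_ac a1) * R ^ q"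
      using R_pos le_R[of "Suc n"] 3 by (intro mult_left_mono power_mono) auto
    also note a1_le
    finally have b1: "nrm (to_ac a1 * \<alpha> (Suc n) ^ q) \<le> 2 * R / R ^ ?Q"
      using R_pos by (simp add: field_simps)
    have "nrm (to_ac a2 * \<alpha> n ^ (q ^ 2)) * R ^ ?Q = nrm (to_ac a2) * (nrm (\<alpha> n) * R ^ (q ^ n)) ^ (q ^ 2)"
      unfolding R2 power_mult_distrib by simp
    also have "\<dots> \<le> nrm (to_ac a2) * R ^ (q ^ 2)"
      using R_pos le_R[of n] 3 by (intro mult_left_mono power_mono) auto
    also note a2_eq
    finally have b2: "nrm (to_ac a2 * \<alpha> n ^ (q ^ 2)) \<le> 2 * R / R ^ ?Q"
      using R_pos by (simp add: field_simps)
    have "nrm (\<alpha> i) * 2 ^ ?Q = nrm (to_ac a1 * \<alpha> (Suc n) ^ q + to_ac a2 * \<alpha> n ^ (q ^ 2))"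
      unfolding 3 using arg_cong[OF \<alpha>_Suc_Suc[of n], of nrm] theta_power_diff[OF Q2] by (simp del: power_Suc)
    also have "\<dots> \<le> 2 * R / R ^ ?Q" by (rule nrm_add_le[OF b1 b2])
    finally have "nrm (\<alpha> i) * R ^ ?Q \<le> 2 * R / 2 ^ ?Q"
      using R_pos by (simp add: field_simps del: power_Suc)
    also note half
    finally show ?thesis unfolding 3 .
  qed
qed

text \<open>With |z| = t R and t \<le> 1, the factor t^(q^i) is at most t. This makes the bound
  proportional to |z| instead of R.\<close>

lemma term_bound:
  assumes "nrm z \<le> R" shows "nrm (\<alpha> i * z ^ (q ^ i)) \<le> nrm z * (1/2) ^ i"
proof -
  have "(nrm z / R) ^ (q ^ i) \<le> (nrm z / R) ^ 1"
    using assms R_pos q_ge_2 by (intro power_decreasing) auto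
  then have "nrm (\<alpha> i) * R ^ (q ^ i) * (nrm z / R) ^ (q ^ i) \<le> R * (1/2) ^ i * (nrm z / R)"
    using R_pos by (intro mult_mono coeff_bound) auto
  then show ?thesis using R_pos by (simp add: power_divide)
qed

text \<open>All terms after the first are at most |z| / 2. This factor makes the exponential
  injective on the disc and the iteration for the logarithm contracting.\<close>

lemma nrm_exp_sum_diff:
  assumes "nrm z \<le> R" shows "nrm (exp_sum z n - z) \<le> nrm z / 2"
proof -
  have "exp_sum z n - z = (\<Sum>i<n. \<alpha> (Suc i) * z ^ (q ^ Suc i))"
    unfolding exp_sum_def by (subst sum.atMost_shift) (simp add: \<alpha>_0)
  also have "nrm \<dots> \<le> nrm z / 2"
  proof (rule nrm_sum_le)
    fix i assume "i \<in> {..<n}"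
    have "nrm z * (1/2) ^ Suc i \<le> nrm z * (1/2) ^ 1" by (intro mult_left_mono power_decreasing) auto
    with term_bound[OF assms, of "Suc i"] show "nrm (\<alpha> (Suc i) * z ^ (q ^ Suc i)) \<le> nrm z / 2" by simp
  qed auto
  finally show ?thesis .
qed

lemma has_exp_disc:
  assumes "nrm z \<le> R" "z \<in> adj y"
  obtains l where "l \<in> adj y" "has_exp z l"
proof (rule adj_complete)
  show "exp_sum z n \<in> adj y" for n by (rule exp_sum_in_adj[OF assms(2)])
  show "ncauchy (exp_sum z)"
  proof (rule tendsto_0_le)
    show "nrm (exp_sum z (Suc n) - exp_sum z n) \<le> nrm z * (1/2) ^ Suc n" for n
      using term_bound[OF assms(1), of "Suc n"] by (simp add: exp_sum_Suc)
    show "(\<lambda>n. nrm z * (1/2) ^ Suc n) \<longlonglongrightarrow> 0"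
      by (intro tendsto_mult_right_zero LIMSEQ_Suc LIMSEQ_power_zero) auto
  qed auto
qed (use that has_exp_def in blast)

text \<open>No estimate for large z is made: z is divided by \<theta> until it lies in the disc of
  radius R, and convergence is carried back by the functional equation. Both directions stay inside
  \<open>adj y\<close>.\<close>

lemma has_exp_adj:
  assumes "z \<in> adj y" obtains l where "l \<in> adj y" "has_exp z l"
proof -
  have th: "inverse \<Theta> \<in> adj y" by (intro adj_inverse to_ac_in_adj)
  have *: "\<exists>l\<in>adj y. has_exp z l" if "nrm z \<le> R * 2 ^ n" "z \<in> adj y" for n z
    using that
  proof (induction n arbitrary: z)
    case 0
    then show ?case using has_exp_disc[of z y] by auto
  next
    case (Suc n)
    have "nrm (inverse \<Theta> * z) \<le> R * 2 ^ n" "inverse \<Theta> * z \<in> adj y"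
      using Suc.prems th by (auto intro: adjD)
    then obtain l where "l \<in> adj y" "has_exp (inverse \<Theta> * z) l" using Suc.IH by blast
    then have "has_exp (\<Theta> * (inverse \<Theta> * z)) (\<phi> l)" "\<phi> l \<in> adj y"
      by (auto intro: has_exp_theta \<phi>_in_adj)
    then show ?case by (auto simp flip: mult.assoc)
  qed
  obtain n where "nrm z / R < 2 ^ n" using real_arch_pow[of 2] by auto
  then have "nrm z \<le> R * 2 ^ n" using R_pos by (simp add: field_simps)
  with *[OF this assms] that show thesis by blast
qed

lemma nrm_has_exp_diff:
  assumes "nrm z \<le> R" "has_exp z l" shows "nrm (l - z) \<le> nrm z / 2"
  using assms(2) unfolding has_exp_def
  by (intro conv_nrm_le[OF _ nrm_exp_sum_diff[OF assms(1)]]) simp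

lemma nrm_has_exp_le:
  assumes "nrm z \<le> R" "has_exp z l" shows "nrm l \<le> nrm z"
  using nrm_has_exp_diff[OF assms] nrm_add[of "l - z" z] nrm_ge0[of z] by (simp add: max_def split: if_splits)

lemma has_exp_0_disc:
  assumes "nrm z \<le> R" "has_exp z 0" shows "z = 0"
  using nrm_has_exp_diff[OF assms] nrm_pos[of z] by (simp del: nrm_pos)

text \<open>The logarithm on the disc, by iterating the contraction \<open>z \<mapsto> z + (x - exp z)\<close>.\<close>
lemma log_exists:
  assumes "nrm x \<le> R" "x \<in> adj y"
  obtains z where "z \<in> adj y" "nrm z \<le> R" "has_exp z x"
proof -
  have "\<forall>z. \<exists>l. z \<in> adj y \<longrightarrow> l \<in> adj y \<and> has_exp z l" using has_exp_adj by metis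
  then obtain E where E: "\<And>z. z \<in> adj y \<Longrightarrow> E z \<in> adj y" "\<And>z. z \<in> adj y \<Longrightarrow> has_exp z (E z)" by metis
  define z where "z = rec_nat 0 (\<lambda>_ u. u + (x - E u))"
  have z0: "z 0 = 0" and zS: "z (Suc n) = z n + (x - E (z n))" for n by (simp_all add: z_def)
  have zA: "z n \<in> adj y" for n
    by (induction n) (auto simp: z0 zS intro!: adjD E assms)
  have dA: "x - E (z n) \<in> adj y" for n by (intro adjD E zA assms)
  have E0: "E 0 = 0"
  proof (rule has_exp_unique[OF E(2)])
    have "exp_sum 0 n = 0" for n by (use q_ge_2 in \<open>simp add: exp_sum_def power_0_left\<close>)
    then show "has_exp 0 0" by (simp add: has_exp_def)
  qed (rule adjD)
  have d: "nrm (x - E (z n)) \<le> nrm x * (1/2) ^ n" for n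
  proof (induction n)
    case 0
    then show ?case by (simp add: z0 E0)
  next
    case (Suc n)
    let ?d = "x - E (z n)"
    have "nrm x * (1/2) ^ n \<le> nrm x * 1" by (intro mult_left_mono power_le_one) auto
    then have dR: "nrm ?d \<le> R" using Suc assms(1) by simp
    \<comment> \<open>By additivity the next error is \<open>?d\<close> minus the exponential of
      \<open>?d\<close>, hence at most half as large as \<open>?d\<close>.\<close>
    have "has_exp (z (Suc n) - z n) (E (z (Suc n)) - E (z n))"
      by (intro has_exp_diff E zA)
    then have "has_exp ?d (E (z (Suc n)) - E (z n))" by (simp add: zS)
    from nrm_has_exp_diff[OF dR this] Suc show ?case
      by (simp add: nrm_diff_commute algebra_simps)
  qed
  have lim0: "(\<lambda>n. nrm x * (1/2) ^ n) \<longlonglongrightarrow> 0"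
    by (intro tendsto_mult_right_zero LIMSEQ_power_zero) auto
  have zR: "nrm (z n) \<le> R" for n
  proof (induction n)
    case (Suc n)
    have "nrm x * (1/2) ^ n \<le> nrm x * 1" by (intro mult_left_mono power_le_one) auto
    then show ?case unfolding zS using Suc d[of n] assms(1) by (intro nrm_add_le) auto
  qed (use R_pos in \<open>simp add: z0\<close>)
  have "ncauchy z"
    by (rule tendsto_0_le[OF lim0]) (use d in \<open>auto simp: zS\<close>)
  then obtain l where l: "l \<in> adj y" "conv z l" using adj_complete[of z y] zA by blast
  have lR: "nrm l \<le> R" by (rule conv_nrm_le[OF l(2) zR])
  \<comment> \<open>On the disc the exponential does not increase distances, so it may be applied to
    the limit.\<close>
  have "conv (\<lambda>n. E (z n)) (E l)"
  proof (rule tendsto_0_le[OF l(2)])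
    show "nrm (E (z n) - E l) \<le> nrm (z n - l)" for n
      by (intro nrm_has_exp_le nrm_diff_le zR lR has_exp_diff E zA l)
  qed auto
  moreover have "conv (\<lambda>n. E (z n)) x"
    by (rule tendsto_0_le[OF lim0]) (use d in \<open>auto simp: nrm_diff_commute\<close>)
  ultimately have "E l = x" by (rule conv_unique)
  then show thesis using that[OF l(1) lR] E(2)[OF l(1)] by simp
qed

text \<open>If |x| = t R with t > 1, the top term of \<phi>(x) has absolute value 2 R t^(q^2) and
  strictly dominates the other two, so it cannot be cancelled.\<close>

lemma nrm_torsion_le:
  assumes "x \<in> torsion_theta a1 a2" shows "nrm x \<le> R"
proof (rule ccontr)
  assume n: "\<not> nrm x \<le> R"
  define t where "t = nrm x / R"
  have t: "t > 1" "nrm x = t * R" using n R_pos by (auto simp: t_def)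
  have q: "1 < q ^ 2" "q < q ^ 2"
    using power_strict_increasing[of 0 2 q] power_strict_increasing[of 1 2 q] q_ge_2 by simp_all
  have 2: "nrm (to_ac a2 * x ^ (q ^ 2)) = 2 * R * t ^ (q ^ 2)"
    using a2_eq by (simp add: t(2) power_mult_distrib mult_ac flip: mult.assoc)
  have "nrm (\<Theta> * x) = 2 * R * t ^ 1" by (simp add: t(2))
  also have "\<dots> < 2 * R * t ^ (q ^ 2)"
    using t(1) q R_pos by (intro mult_strict_left_mono power_strict_increasing) auto
  finally have 0: "nrm (\<Theta> * x) < 2 * R * t ^ (q ^ 2)" .
  have "nrm (to_ac a1 * x ^ q) = (nrm (to_ac a1) * R ^ q) * t ^ q"
    by (simp add: t(2) power_mult_distrib mult_ac)
  also have "\<dots> \<le> 2 * R * t ^ q" using t(1) by (intro mult_right_mono a1_le) auto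
  also have "\<dots> < 2 * R * t ^ (q ^ 2)"
    using t(1) q R_pos by (intro mult_strict_left_mono power_strict_increasing) auto
  finally have 1: "nrm (to_ac a1 * x ^ q) < 2 * R * t ^ (q ^ 2)" .
  have "\<phi> x = 0" using assms by (simp add: torsion_theta_def)
  then have "to_ac a2 * x ^ (q ^ 2) = - (\<Theta> * x + to_ac a1 * x ^ q)"
    unfolding \<phi>_def by (simp only: eq_neg_iff_add_eq_0 add_ac)
  then have "nrm (to_ac a2 * x ^ (q ^ 2)) = nrm (\<Theta> * x + to_ac a1 * x ^ q)" by (simp only: nrm_minus)
  also have "\<dots> < 2 * R * t ^ (q ^ 2)" using nrm_add[of "\<Theta> * x" "to_ac a1 * x ^ q"] 0 1 by linarith
  finally show False using 2 by simp
qed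

lemma torsion_in_adj_period:
  assumes "x \<in> torsion_theta a1 a2"
  obtains \<omega> where "\<omega> \<in> period_lattice a1 a2" "x \<in> adj \<omega>"
proof -
  obtain z where z: "has_exp z x"
    using log_exists[OF nrm_torsion_le[OF assms] self_in_adj] by blast
  have "has_exp (\<Theta> * z) 0" using has_exp_theta[OF z] assms by (simp add: torsion_theta_def)
  moreover have "x \<in> adj (\<Theta> * z)"
  proof -
    have "inverse \<Theta> * (\<Theta> * z) \<in> adj (\<Theta> * z)"
      by (intro adjD(6) adj_inverse to_ac_in_adj self_in_adj)
    then have "z \<in> adj (\<Theta> * z)" by (simp flip: mult.assoc)
    then obtain l where "l \<in> adj (\<Theta> * z)" "has_exp z l" by (rule has_exp_adj)
    then show ?thesis using has_exp_unique[OF z] by simp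
  qed
  ultimately show thesis using that period_lattice_iff by blast
qed

lemma period_lattice_subset_adj:
  assumes V: "torsion_theta a1 a2 \<subseteq> adj y"
  shows "period_lattice a1 a2 \<subseteq> adj y"
proof
  fix \<omega> assume "\<omega> \<in> period_lattice a1 a2"
  \<comment> \<open>Induction on the size of the period. At n = 0 it lies in the disc, where 0 is
    the only period.\<close>
  moreover have "\<omega> \<in> adj y" if "has_exp \<omega> 0" "nrm \<omega> \<le> R * 2 ^ n" for n \<omega>
    using that
  proof (induction n arbitrary: \<omega>)
    case 0
    then show ?case using has_exp_0_disc[of \<omega>] by (simp add: adjD)
  next
    case (Suc n)
    define \<mu> where "\<mu> = inverse \<Theta> * \<omega>"
    have \<omega>: "\<omega> = \<Theta> * \<mu>" by (simp add: \<mu>_def flip: mult.assoc)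
    \<comment> \<open>\<mu> is not yet known to lie in \<open>adj y\<close>, so its exponential is
      formed in \<open>adj \<mu>\<close>. The value is a torsion point, and this brings it into
      \<open>adj y\<close>.\<close>
    obtain x where x: "has_exp \<mu> x" using has_exp_adj[OF self_in_adj] by blast
    have "\<phi> x = 0" using has_exp_theta[OF x] Suc.prems(1) has_exp_unique \<omega> by blast
    then have xV: "x \<in> torsion_theta a1 a2" by (simp add: torsion_theta_def)
    then obtain z where z: "z \<in> adj y" "nrm z \<le> R" "has_exp z x"
      using log_exists[OF nrm_torsion_le[OF xV]] V by blast
    have "has_exp (\<mu> - z) 0" using has_exp_diff[OF x z(3)] by simp
    moreover have "nrm (\<mu> - z) \<le> R * 2 ^ n"
    proof (rule nrm_diff_le)
      show "nrm \<mu> \<le> R * 2 ^ n" using Suc.prems(2) by (simp add: \<mu>_def)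
      have "R * 1 \<le> R * 2 ^ n" using R_pos by (intro mult_left_mono) auto
      then show "nrm z \<le> R * 2 ^ n" using z(2) by simp
    qed
    ultimately have "\<mu> - z \<in> adj y" by (rule Suc.IH)
    then have "\<Theta> * (\<mu> - z + z) \<in> adj y"
      by (rule adjD(6)[OF to_ac_in_adj adjD(5)[OF _ z(1)]])
    then show ?case by (simp add: \<omega>)
  qed
  moreover obtain n where "nrm \<omega> / R < 2 ^ n" using real_arch_pow[of 2] by auto
  then have "nrm \<omega> \<le> R * 2 ^ n" using R_pos by (simp add: field_simps)
  ultimately show "\<omega> \<in> adj y" by (auto simp: period_lattice_iff)
qed

end

text \<open>R = 2^w solves |a2| R^(q^2) = |\<theta>| R, that is, w (q^2 - 1) = 1 + v(a2). The bound
  on a1 then reads w (q - 1) \<le> v(a1) + 1, and multiplied by q + 1 this is the valuation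
  hypothesis.\<close>

lemma one_slope_radius:
  fixes a1 a2 :: "'a::{finite,field} fls"
  assumes "a2 \<noteq> 0"
    and v: "vK a1 \<ge> (vK a2 - ereal (real CARD('a))) / ereal (real CARD('a) + 1)"
  obtains R where "one_slope_drinfeld_module a1 a2 CARD('a) R"
proof -
  let ?q = "real CARD('a)"
  define w where "w = (1 + real_of_int (fls_subdegree a2)) / (?q ^ 2 - 1)"
  define R where "R = 2 powr w"
  have q2: "?q \<ge> 2" using card_ge_2[where 'a = 'a] by simp
  have "1 < ?q ^ 2" using q2 by (simp add: one_less_power)
  then have wq: "w * (?q ^ 2 - 1) = 1 + real_of_int (fls_subdegree a2)" by (simp add: w_def)
  have Rpow: "R ^ n = 2 powr (w * real n)" for n
    unfolding R_def by (simp add: powr_powr flip: powr_realpow)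
  show thesis
  proof (rule that[of R], unfold_locales)
    show "CARD('a) = CARD('a)" ..
    show "R > 0" by (simp add: R_def)
    have "nrm (to_ac a2) * R ^ (CARD('a) ^ 2) = 2 powr (- real_of_int (fls_subdegree a2) + w * ?q ^ 2)"
      unfolding Rpow by (simp only: nrm_to_ac[OF assms(1)] powr_add of_nat_power)
    also have "- real_of_int (fls_subdegree a2) + w * ?q ^ 2 = 1 + w" using wq by (simp add: algebra_simps)
    finally show "nrm (to_ac a2) * R ^ (CARD('a) ^ 2) = 2 * R" by (simp add: powr_add R_def)
    show "nrm (to_ac a1) * R ^ CARD('a) \<le> 2 * R"
    proof (cases "a1 = 0")
      case False
      have "vK a1 = ereal (real_of_int (fls_subdegree a1))" "vK a2 = ereal (real_of_int (fls_subdegree a2))"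
        using False assms(1) by (simp_all add: vK_def)
      then have "(real_of_int (fls_subdegree a2) - ?q) / (?q + 1) \<le> real_of_int (fls_subdegree a1)"
        using v by simp
      then have "real_of_int (fls_subdegree a2) - ?q \<le> real_of_int (fls_subdegree a1) * (?q + 1)"
        by (simp add: pos_divide_le_eq)
      then have "(w * (?q - 1)) * (?q + 1) \<le> (real_of_int (fls_subdegree a1) + 1) * (?q + 1)"
        using wq by (simp add: algebra_simps power2_eq_square)
      then have "w * (?q - 1) \<le> real_of_int (fls_subdegree a1) + 1"
        by (rule mult_right_le_imp_le) simp
      then have "2 powr (- real_of_int (fls_subdegree a1) + w * ?q) \<le> 2 powr (1 + w)"
        by (simp add: algebra_simps)
      then show ?thesis unfolding Rpow nrm_to_ac[OF False] unfolding R_def by (simp only: powr_add) simp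
    qed (simp add: R_def)
  qed
qed

section \<open>The degree of the torsion field\<close>

lemma is_subfield_adj: "is_subfield (adj (x :: 'a::{finite,field} fls alg_closure))"
  unfolding is_subfield_def by (auto intro: adjD adj_inverse)

lemma adj_subset_subfield:
  assumes K: "is_subfield K" "range to_ac \<subseteq> K" "x \<in> K"
  shows "adj x \<subseteq> K"
proof
  fix z assume "z \<in> adj x"
  then obtain p where "z = ev p x" by (auto simp: adj_def)
  moreover have "ev p x \<in> K"
  proof -
    have "to_ac a \<in> K" for a using K(2) by auto
    then show ?thesis using K(1,3) by (induction p) (auto simp: is_subfield_def)
  qed
  ultimately show "z \<in> K" by simp
qed

lemma adj_eq_Kinf_adjoin:
  assumes "S \<subseteq> adj x" "\<And>K. is_subfield K \<Longrightarrow> range to_ac \<subseteq> K \<Longrightarrow> S \<subseteq> K \<Longrightarrow> x \<in> K"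
  shows "Kinf_adjoin S = adj x"
proof
  show "Kinf_adjoin S \<subseteq> adj x"
    unfolding Kinf_adjoin_def using is_subfield_adj[of x] to_ac_in_adj[of _ x] assms(1) by blast
  show "adj x \<subseteq> Kinf_adjoin S"
    unfolding Kinf_adjoin_def using adj_subset_subfield assms(2) by blast
qed

lemma ext_degree_adj:
  fixes y :: "'a::{finite,field} fls alg_closure"
  shows "ext_degree (adj y) = degree (min_poly y)"
proof -
  let ?n = "degree (min_poly y)"
  interpret vector_space "\<lambda>c x :: 'a fls alg_closure. to_ac c * x"
    by unfold_locales (auto simp: algebra_simps)
  \<comment> \<open>Independence of the powers of y below the degree, in terms of
    polynomials.\<close>
  have small: "p = 0" if "ev p y = 0" "\<And>i. i \<ge> ?n \<Longrightarrow> coeff p i = 0" for p :: "'a fls poly"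
  proof (rule ccontr)
    assume "p \<noteq> 0"
    then have "?n \<le> degree p" using that(1) by (rule min_poly_minimal)
    then have "lead_coeff p = 0" by (rule that(2))
    then show False using \<open>p \<noteq> 0\<close> by simp
  qed
  have inj: "inj_on (\<lambda>i. y ^ i) {..<?n}"
  proof (rule inj_onI)
    fix i j assume ij: "i \<in> {..<?n}" "j \<in> {..<?n}" "y ^ i = y ^ j"
    then have "monom 1 i - monom 1 j = (0 :: 'a fls poly)"
      by (intro small) auto
    then have "coeff (monom 1 i) i = coeff (monom (1 :: 'a fls) j) i" by simp
    then show "i = j" by (simp split: if_splits)
  qed
  let ?B = "(\<lambda>i. y ^ i) ` {..<?n}"
  have "independent ?B"
  proof (rule independent_if_scalars_zero)
    fix f x assume s: "(\<Sum>x\<in>?B. to_ac (f x) * x) = 0" and x: "x \<in> ?B"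
    define p where "p = (\<Sum>i<?n. monom (f (y ^ i)) i)"
    have evs: "ev (sum g A) y = (\<Sum>i\<in>A. ev (g i) y)" for g and A :: "nat set"
      by (induction A rule: infinite_finite_induct) auto
    have c: "coeff p i = (if i < ?n then f (y ^ i) else 0)" for i
      by (simp add: p_def coeff_sum if_distrib[of "\<lambda>z. z = _"] sum.delta cong: if_cong)
    have "ev p y = (\<Sum>x\<in>?B. to_ac (f x) * x)"
      unfolding p_def evs by (simp add: sum.reindex[OF inj])
    then have "p = 0" using s by (intro small) (auto simp: c)
    moreover obtain i where "i < ?n" "x = y ^ i" using x by auto
    ultimately show "f x = 0" using c[of i] by simp
  qed simp
  moreover have "?B \<subseteq> adj y" by (auto intro: adjD self_in_adj)
  moreover have "adj y \<subseteq> span ?B"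
  proof
    fix z assume "z \<in> adj y"
    then obtain p where p: "z = ev p y" "\<forall>i\<ge>?n. coeff p i = 0"
      unfolding adj_eq_pspan by (auto simp: pspan_def)
    have "z = (\<Sum>i\<le>degree p. to_ac (coeff p i) * y ^ i)"
      unfolding p(1) by (simp add: poly_altdef degree_map_poly coeff_map_poly)
    also have "\<dots> \<in> span ?B"
    proof (rule span_sum)
      fix i
      show "to_ac (coeff p i) * y ^ i \<in> span ?B"
        using p(2) by (cases "i < ?n") (auto intro: span_scale span_base span_zero)
    qed
    finally show "z \<in> span ?B" .
  qed
  ultimately have "card ?B = dim (adj y)" by (intro basis_card_eq_dim)
  then show ?thesis unfolding ext_degree_def by (simp add: card_image[OF inj])
qed

section \<open>Separability: simple roots, vanishing derivatives, conjugacy classes\<close>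

lemma card_roots_eq_degree:
  fixes p :: "'b::alg_closed_field poly"
  assumes "p \<noteq> 0" "\<And>x. poly p x = 0 \<Longrightarrow> poly (pderiv p) x \<noteq> 0"
  shows "card {x. poly p x = 0} = degree p"
proof -
  obtain A where A: "size A = degree p" "p = smult (lead_coeff p) (\<Prod>a\<in>#A. [:- a, 1:])"
    using alg_closed_imp_factorization[OF assms(1)] by blast
  define c where "c = lead_coeff p"
  have lc: "c \<noteq> 0" using assms(1) by (simp add: c_def)
  have p: "p = smult c (\<Prod>a\<in>#A. [:- a, 1:])" using A(2) unfolding c_def .
  have "poly p x = c * (\<Prod>a\<in>#A. x - a)" for x
    unfolding p by (simp add: poly_prod_mset image_mset.compositionality o_def)
  then have "{x. poly p x = 0} = set_mset A"
    using lc by (auto simp: prod_mset_zero_iff)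
  moreover have "count A x = 1" if x: "x \<in># A" for x
  proof (rule ccontr)
    assume "count A x \<noteq> 1"
    obtain A' where A': "A = add_mset x A'" using multi_member_split[OF x] by blast
    then have "x \<in># A'" using \<open>count A x \<noteq> 1\<close> by (simp add: not_in_iff)
    then obtain B where B: "A = add_mset x (add_mset x B)" using A' multi_member_split by metis
    define r where "r = smult c (\<Prod>a\<in>#B. [:- a, 1:])"
    have r: "p = [:- x, 1:] * ([:- x, 1:] * r)"
      unfolding p B r_def by (simp only: image_mset_add_mset prod_mset.add_mset mult_smult_right)
    have "poly p x = 0" "poly (pderiv p) x = 0" unfolding r pderiv_mult by simp_all
    with assms(2) show False by blast
  qed
  then have "card (set_mset A) = size A" by (simp add: size_multiset_overloaded_eq)
  ultimately show ?thesis using A(1) by simp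
qed

text \<open>Translation by 1 permutes the field, so adding q copies of 1 leaves the sum of all
  elements unchanged.\<close>

lemma of_nat_card_eq_0: "of_nat CARD('a) = (0 :: 'a::{finite,field})"
proof -
  have "(\<Sum>c\<in>UNIV. c) = (\<Sum>c\<in>UNIV. c + (1 :: 'a))"
    by (rule sum.reindex_bij_witness[of _ "\<lambda>c. c + 1" "\<lambda>c. c - 1"]) auto
  then show ?thesis by (simp add: sum.distrib)
qed

lemma of_nat_card_fls_eq_0: "of_nat CARD('a) = (0 :: 'a::{finite,field} fls)"
  using of_nat_card_eq_0[where 'a = 'a] by (metis fls_const_0 fls_of_nat)

lemma pderiv_power_card:
  fixes p :: "'a::{finite,field} fls poly"
  assumes "k > 0" shows "pderiv (p ^ (CARD('a) ^ k)) = 0"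
proof -
  have "of_nat (CARD('a) ^ k) = (0 :: 'a fls)" using assms by (simp add: of_nat_card_fls_eq_0)
  then show ?thesis by (simp add: pderiv_power del: of_nat_power)
qed

lemma pderiv_map_poly_to_ac: "pderiv (map_poly to_ac p) = map_poly to_ac (pderiv p)"
  by (rule poly_eqI) (simp add: coeff_pderiv coeff_map_poly)

text \<open>The condition is symmetric in y and z, so that the classes obviously partition the
  closure; \<open>conjugates_eq\<close> gives the roots of the minimal polynomial.\<close>

definition conjugates :: "'a::{finite,field} fls alg_closure \<Rightarrow> 'a fls alg_closure set" where
  "conjugates y = {z. \<forall>p. ev p z = 0 \<longleftrightarrow> ev p y = 0}"

lemma conjugates_eq: "conjugates y = {z. ev (min_poly y) z = 0}"
  unfolding conjugates_def using ev_conjugate_eq_0_iff[of y] ev_min_poly[of y] by blast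

lemma conjugates_disjoint: "conjugates x \<noteq> conjugates y \<Longrightarrow> conjugates x \<inter> conjugates y = {}"
  unfolding conjugates_def by auto

text \<open>G certifies separability: the minimal polynomial divides G, so a multiple root of it
  would be a zero of the derivative of G, which is 1.\<close>

lemma card_conjugates:
  fixes y :: "'a::{finite,field} fls alg_closure"
  assumes G: "ev G y = 0" "pderiv G = 1"
  shows "card (conjugates y) = degree (min_poly y)"
proof -
  let ?m = "map_poly to_ac (min_poly y) :: 'a fls alg_closure poly"
  obtain k where k: "G = min_poly y * k" using G(1) min_poly_dvd_iff[of y G] by (auto elim: dvdE)
  have "card {z. poly ?m z = 0} = degree ?m"
  proof (rule card_roots_eq_degree)
    show "?m \<noteq> 0" using min_poly_nz[of y] by (simp add: map_poly_eq_0_iff)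
    fix z assume z: "poly ?m z = 0"
    show "poly (pderiv ?m) z \<noteq> 0"
    proof
      assume "poly (pderiv ?m) z = 0"
      then have "ev (pderiv G) z = 0" using z unfolding k by (simp add: pderiv_mult pderiv_map_poly_to_ac)
      then show False using G(2) by simp
    qed
  qed
  then show ?thesis by (simp add: conjugates_eq degree_map_poly)
qed

section \<open>The torsion as an F_q-plane, its bases and primitive elements\<close>

locale rank2_drinfeld_module = drinfeld_module +
  assumes a2_nz: "a2 \<noteq> 0"
begin

abbreviation V :: "'a fls alg_closure set" where "V \<equiv> torsion_theta a1 a2"

lemma V_iff: "x \<in> V \<longleftrightarrow> \<phi> x = 0" by (simp add: torsion_theta_def)

definition phi_poly :: "'a fls poly" where
  "phi_poly = monom fls_X_inv 1 + monom a1 q + monom a2 (q ^ 2)"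

lemma ev_phi_poly: "ev phi_poly x = \<phi> x" by (simp add: phi_poly_def \<phi>_def)

lemma q_less_square: "1 < q ^ 2" "q < q ^ 2"
  using power_strict_increasing[of 0 2 q] power_strict_increasing[of 1 2 q] q_ge_2 by simp_all

lemma degree_phi_poly: "degree phi_poly = q ^ 2"
proof -
  have "degree (monom fls_X_inv 1 + monom a1 q) < degree (monom a2 (q ^ 2))"
    using q_less_square degree_monom_le[of a1 q] degree_monom_le[of "fls_X_inv :: 'a fls" 1]
      degree_add_le_max[of "monom fls_X_inv 1" "monom a1 q"] a2_nz by (simp add: degree_monom_eq)
  then show ?thesis unfolding phi_poly_def using a2_nz by (simp add: degree_add_eq_right degree_monom_eq)
qed

lemma pderiv_phi_poly: "pderiv phi_poly = [:fls_X_inv:]"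
proof -
  have "of_nat q = (0 :: 'a fls)" using of_nat_card_fls_eq_0[where 'a = 'a] by (simp add: q_card)
  then show ?thesis by (simp add: phi_poly_def pderiv_add pderiv_monom monom_0)
qed

text \<open>The derivative of \<open>phi_poly\<close> is the nonzero constant \<theta>, so all its
  zeros are simple.\<close>

lemma card_V: "card V = q ^ 2"
proof -
  let ?p = "map_poly to_ac phi_poly :: 'a fls alg_closure poly"
  have "card {x. poly ?p x = 0} = degree ?p"
  proof (rule card_roots_eq_degree)
    have "phi_poly \<noteq> 0" using degree_phi_poly q_less_square by auto
    then show "?p \<noteq> 0" by (simp add: map_poly_eq_0_iff)
  qed (simp add: pderiv_map_poly_to_ac pderiv_phi_poly)
  then show ?thesis by (simp add: degree_map_poly degree_phi_poly ev_phi_poly torsion_theta_def)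
qed

lemma finite_V: "finite V" using card_V q_less_square by (metis card.infinite not_less_zero)

lemma \<phi>_add: "\<phi> (x + y) = \<phi> x + \<phi> y"
  by (simp add: \<phi>_def frob_add frob_add_power algebra_simps)

lemma V_add: "x \<in> V \<Longrightarrow> y \<in> V \<Longrightarrow> x + y \<in> V"
  by (simp add: V_iff \<phi>_add)

lemma fconst_power_q: "fconst (c :: 'a) ^ q = fconst c" "fconst c ^ (q ^ 2) = fconst c"
  using fconst_power_card[of c] by (simp_all add: q_card power2_eq_square power_mult)

lemma V_scale: "x \<in> V \<Longrightarrow> fconst c * x \<in> V"
proof -
  have "\<phi> (fconst c * x) = fconst c * \<phi> x"
    by (simp add: \<phi>_def power_mult_distrib fconst_power_q algebra_simps)
  then show "x \<in> V \<Longrightarrow> fconst c * x \<in> V" by (simp add: V_iff)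
qed

lemma V_0: "0 \<in> V" using q_ge_2 by (simp add: V_iff \<phi>_def power_0_left)

definition bases :: "('a fls alg_closure \<times> 'a fls alg_closure) set" where
  "bases = Sigma (V - {0}) (\<lambda>b. V - range (\<lambda>c. fconst c * b))"

lemma card_bases: "card bases = (q ^ 2 - 1) * (q ^ 2 - q)"
proof -
  have "card (V - range (\<lambda>c. fconst c * b)) = q ^ 2 - q" if b: "b \<in> V - {0}" for b
  proof -
    have "b \<noteq> 0" using b by simp
    then have "inj (\<lambda>c. fconst c * b)"
      by (intro injI injD[OF inj_fconst]) (unfold mult_cancel_right, blast)
    then have "card (range (\<lambda>c. fconst c * b)) = q" by (simp add: card_image q_card)
    moreover have "range (\<lambda>c. fconst c * b) \<subseteq> V" using b V_scale by auto
    ultimately show ?thesis using card_V by (subst card_Diff_subset) auto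
  qed
  then have "card bases = (\<Sum>b\<in>V - {0}. q ^ 2 - q)"
    unfolding bases_def by (subst card_SigmaI) (auto simp: finite_V)
  also have "\<dots> = (q ^ 2 - 1) * (q ^ 2 - q)"
    using card_V V_0 finite_V by simp
  finally show ?thesis .
qed

text \<open>Counting replaces dimension theory over F_q: the q^2 combinations of b1 and b2 are
  distinct, and V has q^2 elements.\<close>

lemma V_spanned:
  assumes "(b1, b2) \<in> bases" "x \<in> V"
  obtains c d where "x = fconst c * b1 + fconst d * b2"
proof -
  have b: "b1 \<in> V" "b1 \<noteq> 0" "b2 \<in> V" "\<And>c. b2 \<noteq> fconst c * b1"
    using assms(1) by (auto simp: bases_def)
  let ?f = "\<lambda>(c, d). fconst c * b1 + fconst d * b2"
  have "inj ?f"
  proof (rule injI, safe)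
    fix c d c' d' assume e: "fconst c * b1 + fconst d * b2 = fconst c' * b1 + fconst d' * b2"
    have d: "d = d'"
    proof (rule ccontr)
      assume "d \<noteq> d'"
      then have nz: "fconst (d - d') \<noteq> 0" by simp
      have "fconst (d - d') * b2 = fconst (c' - c) * b1"
        using e by (simp add: algebra_simps flip: fls_minus_const)
      then have e': "inverse (fconst (d - d')) * (fconst (d - d') * b2) = inverse (fconst (d - d')) * (fconst (c' - c) * b1)"
        by simp
      have "b2 = inverse (fconst (d - d')) * (fconst (d - d') * b2)"
        by (simp only: mult.assoc[symmetric] left_inverse[OF nz] mult_1_left)
      also note e'
      also have "inverse (fconst (d - d')) * (fconst (c' - c) * b1) = fconst (inverse (d - d') * (c' - c)) * b1"
        by (simp only: fls_const_mult_const[symmetric] to_ac_mult fls_inverse_const[symmetric] to_ac_inverse mult.assoc)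
      finally show False using b(4) by blast
    qed
    then show "d = d'" .
    have "fconst c * b1 = fconst c' * b1" using e d by simp
    then have "fconst c = fconst c'" using b(2) unfolding mult_cancel_right by blast
    then show "c = c'" by (rule injD[OF inj_fconst])
  qed
  then have "card (range ?f) = q ^ 2" by (simp add: card_image q_card card_prod power2_eq_square)
  moreover have "range ?f \<subseteq> V" using b V_add V_scale by auto
  ultimately have "range ?f = V" using card_V finite_V by (intro card_subset_eq) auto
  with assms(2) have "x \<in> range ?f" by simp
  then obtain cd where "x = ?f cd" by blast
  then show thesis using that[of "fst cd" "snd cd"] by (simp add: case_prod_beta)
qed

text \<open>For b in V, removing b^(q^2) by means of \<phi>(b) = 0 gives \<phi>(g b) =
  \<open>coeff1 g\<close> b + \<open>coeff2 g\<close> b^q. In the same way a2 \<phi>(g b)^q =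
  \<open>elim_coeff g\<close> b^q - \<theta> \<open>coeff2 g\<close>^q b, and
  \<open>elim_det g\<close> is the determinant of these two forms in b and b^q.\<close>

definition coeff1 :: "'a fls \<Rightarrow> 'a fls" where "coeff1 g = fls_X_inv * (g - g ^ (q ^ 2))"
definition coeff2 :: "'a fls \<Rightarrow> 'a fls" where "coeff2 g = a1 * (g ^ q - g ^ (q ^ 2))"
definition elim_coeff :: "'a fls \<Rightarrow> 'a fls" where "elim_coeff g = a2 * coeff1 g ^ q - a1 * coeff2 g ^ q"
definition elim_det :: "'a fls \<Rightarrow> 'a fls" where "elim_det g = elim_coeff g * coeff1 g + fls_X_inv * coeff2 g ^ (q + 1)"

text \<open>A small g of absolute value e works, namely a high power of 1/\<theta>. Then a2
  \<open>coeff1 g\<close>^(q+1) has absolute value |a2| (2e)^(q+1), while the other two terms of the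
  determinant carry at least the factor e^(q+2).\<close>

lemma elim_det_nonzero_exists: "\<exists>g. elim_det g \<noteq> 0"
proof -
  let ?n = "\<lambda>x :: 'a fls. nrm (to_ac x)"
  have pos: "?n a2 > 0" using a2_nz by simp
  \<comment> \<open>The summand 1 keeps the threshold meaningful for a1 = 0. Below the threshold,
    |a1|^(q+1) e < |a2|.\<close>
  then have "?n a2 / (?n a1 ^ (q + 1) + 1) > 0"
    by (intro divide_pos_pos add_nonneg_pos) auto
  then obtain N0 where N0: "(1/2) ^ N0 < ?n a2 / (?n a1 ^ (q + 1) + 1)"
    using real_arch_pow_inv[of _ "1/2 :: real"] by auto
  define g where "g = (fls_X :: 'a fls) ^ Suc N0"
  define e where "e = ?n g"
  have "?n fls_X = 1/2" by (simp add: nrm_to_ac powr_minus)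
  then have e: "e = (1/2) ^ Suc N0" by (simp only: e_def g_def to_ac_power nrm_power)
  have e0: "e > 0" by (simp add: e)
  have e1: "e < 1" unfolding e by (rule power_Suc_less_one) auto
  have "e \<le> (1/2) ^ N0" by (simp add: e)
  then have "e < ?n a2 / (?n a1 ^ (q + 1) + 1)" using N0 by simp
  moreover have p1: "?n a1 ^ (q + 1) + 1 > 0" by (intro add_nonneg_pos) auto
  ultimately have "e * (?n a1 ^ (q + 1) + 1) < ?n a2" by (simp add: pos_less_divide_eq)
  then have key: "?n a1 ^ (q + 1) * e < ?n a2" using e0 by (simp add: algebra_simps)
  have q: "1 < q ^ 2" "q < q ^ 2" "q + 2 \<le> q ^ 2 + 1"
    using q_less_square by auto
  have ncoeff1: "?n (coeff1 g) = 2 * e"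
  proof -
    have "e ^ (q ^ 2) < e ^ 1" using q e0 e1 by (intro power_strict_decreasing) auto
    then have "nrm (to_ac g - to_ac g ^ (q ^ 2)) = e" unfolding e_def by (subst nrm_diff_eq) auto
    then show ?thesis by (simp add: coeff1_def)
  qed
  have ncoeff2: "?n (coeff2 g) = ?n a1 * e ^ q"
  proof -
    have "e ^ (q ^ 2) < e ^ q" using q e0 e1 by (intro power_strict_decreasing) auto
    then have "nrm (to_ac g ^ q - to_ac g ^ (q ^ 2)) = e ^ q" unfolding e_def by (subst nrm_diff_eq) auto
    then show ?thesis by (simp add: coeff2_def)
  qed
  let ?t1 = "a2 * coeff1 g ^ (q + 1)" and ?t2 = "a1 * coeff1 g * coeff2 g ^ q" and ?t3 = "fls_X_inv * coeff2 g ^ (q + 1)"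
  have n1: "?n ?t1 = ?n a2 * (2 ^ (q + 1) * e ^ (q + 1))" by (simp only: to_ac_mult to_ac_power nrm_mult nrm_power ncoeff1 power_mult_distrib)
  have n2: "?n ?t2 = 2 * ?n a1 ^ (q + 1) * e ^ (q ^ 2 + 1)"
    by (simp add: ncoeff1 ncoeff2 power_mult_distrib power2_eq_square flip: power_mult)
  have n3: "?n ?t3 = 2 * ?n a1 ^ (q + 1) * e ^ (q ^ 2 + q)"
    by (simp add: ncoeff2 power_mult_distrib power2_eq_square power_add flip: power_mult)
  have big: "2 * ?n a1 ^ (q + 1) * e ^ m < ?n ?t1" if m: "m \<ge> q + 2" for m
  proof -
    have "2 * ?n a1 ^ (q + 1) * e ^ m \<le> 2 * ?n a1 ^ (q + 1) * e ^ (q + 2)"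
      using m e0 e1 by (intro mult_left_mono power_decreasing) auto
    also have "\<dots> = 2 * (?n a1 ^ (q + 1) * e) * e ^ (q + 1)" by simp
    also have "\<dots> < 2 * ?n a2 * e ^ (q + 1)" using key e0 by (intro mult_strict_right_mono) auto
    also have "\<dots> \<le> 2 ^ (q + 1) * ?n a2 * e ^ (q + 1)"
      using e0 by (intro mult_right_mono) auto
    also have "\<dots> = ?n ?t1" unfolding n1 by simp
    finally show ?thesis .
  qed
  have "?n ?t2 < ?n ?t1" unfolding n2 using q by (intro big) auto
  moreover have "?n ?t3 < ?n ?t1" unfolding n3 using q q_ge_2 by (intro big) auto
  ultimately have "nrm (to_ac ?t2 - to_ac ?t3) < ?n ?t1"
    using nrm_add[of "to_ac ?t2" "- to_ac ?t3"] by simp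
  moreover have "to_ac (elim_det g) = to_ac ?t1 - (to_ac ?t2 - to_ac ?t3)"
    by (simp add: elim_det_def elim_coeff_def algebra_simps)
  ultimately have "?n (elim_det g) = ?n ?t1" by (simp only: nrm_diff_eq)
  moreover have "?n ?t1 > 0" unfolding n1 using pos e0 by simp
  ultimately have "elim_det g \<noteq> 0" by (metis less_irrefl nrm_0 to_ac_0)
  then show ?thesis ..
qed

definition g :: "'a fls" where "g = (SOME g. elim_det g \<noteq> 0)"

lemma elim_det_g: "elim_det g \<noteq> 0" unfolding g_def using elim_det_nonzero_exists by (rule someI_ex)

text \<open>\<open>b1 + g b2\<close> is a primitive element: for \<open>b1, b2\<close> torsion, \<open>\<phi>(b1 + g b2)\<close> is a combination
  of \<open>b2\<close> and \<open>b2^q\<close>, and so is its \<open>q\<close>-th power; \<open>elim_det g\<close> is the determinant of this system.\<close>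
definition snd_coord :: "'a fls poly" where
  "snd_coord = smult (inverse (elim_det g)) (smult (elim_coeff g) phi_poly - smult (a2 * coeff2 g) (phi_poly ^ q))"

definition fst_coord :: "'a fls poly" where "fst_coord = [:0, 1:] - smult g snd_coord"

lemma V_rel: "b \<in> V \<Longrightarrow> to_ac a2 * b ^ (q ^ 2) = - (\<Theta> * b) - to_ac a1 * b ^ q"
  unfolding V_iff \<phi>_def by (simp add: algebra_simps eq_neg_iff_add_eq_0)

lemma ev_snd_coord:
  assumes b: "b1 \<in> V" "b2 \<in> V"
  shows "ev snd_coord (b1 + to_ac g * b2) = b2"
proof -
  define w where "w = \<phi> (b1 + to_ac g * b2)"
  have "w = \<phi> (to_ac g * b2)" using b(1) by (simp add: w_def \<phi>_add V_iff)
  also have "\<dots> = \<Theta> * (to_ac g * b2) + to_ac a1 * to_ac g ^ q * b2 ^ q + to_ac g ^ (q ^ 2) * (to_ac a2 * b2 ^ (q ^ 2))"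
    by (simp add: \<phi>_def power_mult_distrib mult_ac)
  also have "\<dots> = to_ac (coeff1 g) * b2 + to_ac (coeff2 g) * b2 ^ q"
    unfolding V_rel[OF b(2)] by (simp add: coeff1_def coeff2_def algebra_simps)
  finally have w: "w = to_ac (coeff1 g) * b2 + to_ac (coeff2 g) * b2 ^ q" .
  have "to_ac a2 * w ^ q = to_ac a2 * to_ac (coeff1 g) ^ q * b2 ^ q + to_ac (coeff2 g) ^ q * (to_ac a2 * b2 ^ (q ^ 2))"
    unfolding w by (simp add: frob_add power_mult_distrib power2_eq_square algebra_simps flip: power_mult)
  also have "\<dots> = to_ac (elim_coeff g) * b2 ^ q - \<Theta> * to_ac (coeff2 g) ^ q * b2"
    unfolding V_rel[OF b(2)] by (simp add: elim_coeff_def algebra_simps)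
  finally have wq: "to_ac a2 * w ^ q = to_ac (elim_coeff g) * b2 ^ q - \<Theta> * to_ac (coeff2 g) ^ q * b2" .
  \<comment> \<open>Cramer's rule: this combination cancels b2^q.\<close>
  have "to_ac (elim_coeff g) * w - to_ac (coeff2 g) * (to_ac a2 * w ^ q) = to_ac (elim_det g) * b2"
    unfolding wq unfolding w by (simp add: elim_det_def algebra_simps)
  then show ?thesis using elim_det_g by (simp add: snd_coord_def ev_phi_poly flip: w_def) (simp add: mult_ac)
qed

lemma ev_fst_coord:
  assumes b: "b1 \<in> V" "b2 \<in> V"
  shows "ev fst_coord (b1 + to_ac g * b2) = b1"
  using ev_snd_coord[OF b] by (simp add: fst_coord_def)

definition primitives :: "'a fls alg_closure set" where
  "primitives = (\<lambda>(b1, b2). b1 + to_ac g * b2) ` bases"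

lemma card_primitives: "card primitives = (q ^ 2 - 1) * (q ^ 2 - q)"
proof -
  have "inj_on (\<lambda>(b1, b2). b1 + to_ac g * b2) bases"
  proof (rule inj_onI, safe)
    fix b1 b2 c1 c2 assume *: "(b1, b2) \<in> bases" "(c1, c2) \<in> bases" "b1 + to_ac g * b2 = c1 + to_ac g * c2"
    then have "b1 \<in> V" "b2 \<in> V" "c1 \<in> V" "c2 \<in> V" by (auto simp: bases_def)
    then show "b1 = c1" "b2 = c2" using *(3) ev_fst_coord ev_snd_coord by metis+
  qed
  then show ?thesis unfolding primitives_def by (simp add: card_image card_bases)
qed

lemma Kinf_adjoin_V:
  assumes "y \<in> primitives" shows "Kinf_adjoin V = adj y" and "V \<subseteq> adj y"
proof -
  obtain b1 b2 where b: "(b1, b2) \<in> bases" and y: "y = b1 + to_ac g * b2"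
    using assms by (auto simp: primitives_def)
  have bV: "b1 \<in> V" "b2 \<in> V" using b by (auto simp: bases_def)
  have "ev fst_coord y \<in> adj y" "ev snd_coord y \<in> adj y" by (auto simp: adj_def)
  then have badj: "b1 \<in> adj y" "b2 \<in> adj y" unfolding y using ev_fst_coord[OF bV] ev_snd_coord[OF bV] by simp_all
  show "V \<subseteq> adj y"
  proof
    fix x assume "x \<in> V"
    then obtain c d where "x = fconst c * b1 + fconst d * b2" using V_spanned[OF b] by metis
    then show "x \<in> adj y" using badj by (simp add: adjD to_ac_in_adj)
  qed
  then show "Kinf_adjoin V = adj y"
  proof (rule adj_eq_Kinf_adjoin)
    fix K assume "is_subfield K" "range to_ac \<subseteq> K" "V \<subseteq> K"
    then have "to_ac g \<in> K" "b1 \<in> K" "b2 \<in> K" "is_subfield K" using bV by auto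
    then show "y \<in> K" unfolding y is_subfield_def by blast
  qed
qed

text \<open>Being a basis of V is expressed by polynomial equations and inequations over
  \<open>K_\<infinity>\<close> in the two coordinates. The coordinates are polynomials in y, so a
  conjugate z satisfies the same conditions.\<close>

lemma conjugates_subset_primitives:
  assumes "y \<in> primitives" shows "conjugates y \<subseteq> primitives"
proof
  fix z assume "z \<in> conjugates y"
  then have z: "ev p z = 0 \<longleftrightarrow> ev p y = 0" for p by (simp add: conjugates_def)
  obtain b1 b2 where b: "(b1, b2) \<in> bases" and y: "y = b1 + to_ac g * b2"
    using assms by (auto simp: primitives_def)
  have bV: "b1 \<in> V" "b1 \<noteq> 0" "b2 \<in> V" "\<And>c. b2 \<noteq> fconst c * b1"
    using b by (auto simp: bases_def)
  have evy: "ev fst_coord y = b1" "ev snd_coord y = b2" unfolding y using ev_fst_coord ev_snd_coord bV by auto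
  have "ev (pcompose phi_poly fst_coord) z = 0" "ev (pcompose phi_poly snd_coord) z = 0"
    unfolding z using bV by (simp_all add: evy ev_phi_poly V_iff)
  then have zV: "ev fst_coord z \<in> V" "ev snd_coord z \<in> V" by (simp_all add: ev_phi_poly V_iff)
  moreover have "ev fst_coord z \<noteq> 0" using z[of fst_coord] evy bV by simp
  moreover have "ev snd_coord z \<noteq> fconst c * ev fst_coord z" for c
    using z[of "snd_coord - smult (fls_const c) fst_coord"] evy bV(4)[of c] by simp
  ultimately have "(ev fst_coord z, ev snd_coord z) \<in> bases" by (auto simp: bases_def)
  moreover have "z = ev fst_coord z + to_ac g * ev snd_coord z" by (simp add: fst_coord_def)
  ultimately show "z \<in> primitives" unfolding primitives_def by (auto intro!: image_eqI[of _ _ "(ev fst_coord z, ev snd_coord z)"])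
qed

text \<open>The linear term of \<phi> expressed by the other two: the value is unchanged where p
  takes a value in V, but only q-th powers remain, and their derivative is zero.\<close>

definition inv_frob :: "'a fls poly \<Rightarrow> 'a fls poly" where
  "inv_frob p = smult (- inverse fls_X_inv) (smult a1 (p ^ q) + smult a2 (p ^ (q ^ 2)))"

lemma pderiv_inv_frob: "pderiv (inv_frob p) = 0"
  using pderiv_power_card[of 1 p] pderiv_power_card[of 2 p] unfolding q_card[symmetric]
  by (simp add: inv_frob_def pderiv_smult pderiv_add pderiv_minus)

lemma ev_inv_frob:
  assumes "ev p y \<in> V" shows "ev (inv_frob p) y = ev p y"
proof -
  have "\<Theta> * ev p y = - (to_ac a1 * ev p y ^ q + to_ac a2 * ev p y ^ (q ^ 2))"
    using assms unfolding V_iff \<phi>_def by (simp only: eq_neg_iff_add_eq_0 add_ac)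
  then have "inverse \<Theta> * (\<Theta> * ev p y) = ev (inv_frob p) y"
    by (simp add: inv_frob_def right_diff_distrib distrib_left)
  then show ?thesis by (simp flip: mult.assoc)
qed

text \<open>Separability of a primitive element \<open>y\<close>: the torsion points in \<open>y = b1 + g b2\<close> satisfy
  \<open>b = - (a1 b^q + a2 b^(q^2)) / \<theta>\<close>, so \<open>y\<close> is a zero of a polynomial with derivative 1.\<close>
lemma card_conjugates_primitives:
  assumes "y \<in> primitives" shows "card (conjugates y) = degree (min_poly y)"
proof (rule card_conjugates)
  obtain b1 b2 where "(b1, b2) \<in> bases" and y: "y = b1 + to_ac g * b2"
    using assms by (auto simp: primitives_def)
  then have b: "b1 \<in> V" "b2 \<in> V" by (auto simp: bases_def)
  let ?G = "[:0, 1:] - (inv_frob fst_coord + smult g (inv_frob snd_coord))"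
  have evy: "ev fst_coord y = b1" "ev snd_coord y = b2" unfolding y using ev_fst_coord ev_snd_coord b by auto
  show "ev ?G y = 0" using ev_inv_frob[of fst_coord y] ev_inv_frob[of snd_coord y] b by (simp add: evy) (simp add: y)
  show "pderiv ?G = 1" by (simp add: pderiv_diff pderiv_add pderiv_smult pderiv_inv_frob pderiv_pCons one_pCons)
qed

lemma primitives_nonempty: "primitives \<noteq> {}"
proof
  assume "primitives = {}"
  then have "(q ^ 2 - 1) * (q ^ 2 - q) = 0" using card_primitives by simp
  then show False using q_less_square by simp
qed

lemma degree_dvd: "ext_degree (Kinf_adjoin V) dvd (q ^ 2 - 1) * (q ^ 2 - q)"
proof -
  let ?n = "ext_degree (Kinf_adjoin V)"
  have n: "card (conjugates y) = ?n" if "y \<in> primitives" for y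
    using Kinf_adjoin_V(1)[OF that] card_conjugates_primitives[OF that] by (simp add: ext_degree_adj)
  have "y \<in> conjugates y" for y :: "'a fls alg_closure" by (simp add: conjugates_def)
  then have U: "\<Union> (conjugates ` primitives) = primitives" using conjugates_subset_primitives by blast
  have fin: "finite primitives" using card_primitives q_less_square
    by (metis card.infinite mult_is_0 not_less zero_less_diff less_irrefl diff_is_0_eq)
  have "?n * card (conjugates ` primitives) = card (\<Union> (conjugates ` primitives))"
  proof (rule card_partition)
    show "finite (conjugates ` primitives)" "finite (\<Union> (conjugates ` primitives))" using fin unfolding U by auto
  qed (use n conjugates_disjoint in auto)
  then have "?n * card (conjugates ` primitives) = (q ^ 2 - 1) * (q ^ 2 - q)" unfolding U card_primitives .
  then show ?thesis by (metis dvd_triv_left)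
qed

end

theorem theorem2:
  fixes a1 a2 :: "'a::{finite,field} fls"
  assumes "inK a1" and "inK a2" and "a2 \<noteq> 0"
    and "vK a1 \<ge> (vK a2 - ereal (real CARD('a))) / ereal (real CARD('a) + 1)"
  shows "Kinf_adjoin (period_lattice a1 a2) = Kinf_adjoin (torsion_theta a1 a2)
    \<and> ext_degree (Kinf_adjoin (period_lattice a1 a2))
        dvd (CARD('a) ^ 2 - 1) * (CARD('a) ^ 2 - CARD('a))"
proof -
  obtain R where "one_slope_drinfeld_module a1 a2 CARD('a) R"
    using one_slope_radius[OF assms(3,4)] .
  then interpret one_slope_drinfeld_module a1 a2 "CARD('a)" R .
  interpret rank2_drinfeld_module a1 a2 "CARD('a)"
    by unfold_locales (rule assms(3))
  \<comment> \<open>With a single generator y of the torsion field, all periods can be located in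
    one complete field \<open>adj y\<close>.\<close>
  obtain y where y: "y \<in> primitives" using primitives_nonempty by blast
  have "Kinf_adjoin (period_lattice a1 a2) = adj y"
  proof (rule adj_eq_Kinf_adjoin)
    show "period_lattice a1 a2 \<subseteq> adj y"
      by (rule period_lattice_subset_adj[OF Kinf_adjoin_V(2)[OF y]])
    fix K assume K: "is_subfield K" "range to_ac \<subseteq> K" "period_lattice a1 a2 \<subseteq> K"
    have "V \<subseteq> K"
    proof
      fix x assume "x \<in> V"
      then obtain \<omega> where "\<omega> \<in> period_lattice a1 a2" "x \<in> adj \<omega>" by (rule torsion_in_adj_period)
      then show "x \<in> K" using adj_subset_subfield[OF K(1,2)] K(3) by blast
    qed
    then have "Kinf_adjoin V \<subseteq> K" unfolding Kinf_adjoin_def using K by blast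
    then show "y \<in> K" unfolding Kinf_adjoin_V(1)[OF y] using self_in_adj[of y] by blast
  qed
  then show ?thesis using Kinf_adjoin_V(1)[OF y] degree_dvd by simp
qed

end
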